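(* Let $\mathcal{G}$ be a connected simple undirected graph on $n\ge2$ nodes, let $\tau>0$, let $W\in\mathbb{R}^{n\times n}$ be a gossip matrix on $\mathcal{G}$ with eigengap $\gamma=\gamma(W)<1$, and let $f_i:\mathbb{R}^d\to\mathbb{R}$, $i=1,\dots,n$, be $\alpha$-strongly convex and $\beta$-smooth with $\beta\ge\alpha>0$ and $\kappa_l=\beta/\alpha$. Let $\theta^*$ be the minimizer of $\bar f=\frac1n\sum_{i=1}^nf_i$, and let $\Theta_t=(\theta_{1,t},\dots,\theta_{n,t})\in\mathbb{R}^{d\times n}$ be the iterates of the Multi-Step Dual Accelerated (MSDA) method. Then $\Theta_t\to\theta^*\mathbb{1}^\top$ as $t\to\infty$. Furthermore, the time needed by this algorithm to reach any given precision $\varepsilon>0$ is $$O\left(\sqrt{\kappa_l}\left(1+\frac{\tau}{\sqrt\gamma}\right)\ln\left(\frac1\varepsilon\right)\right),$$ meaning: there is an absolute constant $C>0$, and a constant $D\ge0$ which may depend on the problem instance but not on $\varepsilon$, such that for every $\varepsilon\in(0,1)$ the time to reach precision $\varepsilon$ is at most $C\sqrt{\kappa_l}\,(1+\tau/\sqrt\gamma)\ln(1/\varepsilon)+D$.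
   Context: A function is $\beta$-smooth if it is differentiable with $\beta$-Lipschitz gradient; $f_i^*$ is the Fenchel conjugate of $f_i$; $\mathbb{1}=(1,\dots,1)^\top\in\mathbb{R}^n$. Gossip matrix on $\mathcal{G}=(\mathcal{V},\mathcal{E})$, $\mathcal{V}=\{1,\dots,n\}$: an $n\times n$ real symmetric positive semi-definite matrix $W$ with $\mathrm{Ker}(W)=\mathrm{Span}(\mathbb{1})$ and $W_{ij}\neq0$ only if $i=j$ or $(i,j)\in\mathcal{E}$. With eigenvalues $\lambda_1(W)\ge\cdots\ge\lambda_n(W)=0$, its (normalized) eigengap is $\gamma(W)=\lambda_{n-1}(W)/\lambda_1(W)$. MSDA method: set $c_1=\frac{1-\sqrt\gamma}{1+\sqrt\gamma}$, $c_2=\frac{1+\gamma}{1-\gamma}$, $c_3=\frac{2}{(1+\gamma)\lambda_1(W)}$, $K=\left\lfloor\frac1{\sqrt\gamma}\right\rfloor$, $\eta=\frac{\alpha(1+c_1^{2K})}{(1+c_1^K)^2}$, $\mu=\frac{(1+c_1^K)\sqrt{\kappa_l}-1+c_1^K}{(1+c_1^K)\sqrt{\kappa_l}+1-c_1^K}$, and $x_0=y_0=0\in\mathbb{R}^{d\times n}$. For $t=0,1,2,\dots$: $\theta_{i,t}=\nabla f_i^*(x_{i,t})$ for all $i=1,\dots,n$, where $x_{i,t}$ is the $i$-th column of $x_t$, and $\Theta_t=(\theta_{1,t},\dots,\theta_{n,t})$; $y_{t+1}=x_t-\eta\,\mathrm{AccGossip}(\Theta_t,W,K)$; $x_{t+1}=(1+\mu)y_{t+1}-\mu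 y_t$. The procedure $\mathrm{AccGossip}(x,W,K)$, for $x\in\mathbb{R}^{d\times n}$, is: set $a_0=1$, $a_1=c_2$, $z_0=x$, $z_1=c_2\,x(I-c_3W)$; for $k=1,\dots,K-1$ set $a_{k+1}=2c_2a_k-a_{k-1}$ and $z_{k+1}=2c_2\,z_k(I-c_3W)-z_{k-1}$; return $z_0-z_K/a_K$. Time model: computing the local gradients $\nabla f_i^*$ (in parallel on all nodes) takes time $1$, and one communication between neighbors (one multiplication by $W$) takes time $\tau$; hence one iteration takes time $1+K\tau$. The time to reach precision $\varepsilon$ is the number of iterations needed to have $\max_{1\le i\le n}\bar f(\theta_{i,t})-\bar f(\theta^* )\le\varepsilon$, multiplied by the time per iteration. *)

theory Defs
  imports
    Complex_Main
    "HOL-Library.Extended_Real"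
    "Jordan_Normal_Form.Char_Poly"
    "Jordan_Normal_Form.Matrix_Kernel"
    "Graph_Theory.Pair_Digraph"
    "Graph_Theory.Digraph_Component"
begin

text \<open>
  The constant in a complexity bound is to be independent of the dimensions \<open>d\<close> and \<open>n\<close>,
  so both are ordinary natural numbers: vectors and matrices are those with explicit carriers,
  \<open>carrier_vec d\<close> standing for \<open>R^d\<close>. Functions on \<open>R^d\<close> have type \<open>real vec \<Rightarrow> real\<close>; only their
  values on \<open>carrier_vec d\<close> matter. Nodes are numbered from \<open>0\<close> to \<open>n - 1\<close>.
\<close>

subsection \<open>Functions on a Euclidean space with explicit dimension\<close>

definition vnorm :: "real vec \<Rightarrow> real" where
  "vnorm v = sqrt (v \<bullet> v)"

text \<open>Frechet differentiability at \<open>x\<close>, with the derivative represented by the vector \<open>g\<close>.\<close>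

definition has_gradient :: "nat \<Rightarrow> (real vec \<Rightarrow> real) \<Rightarrow> real vec \<Rightarrow> real vec \<Rightarrow> bool" where
  "has_gradient d f g x \<longleftrightarrow> g \<in> carrier_vec d \<and>
     (\<forall>e>0. \<exists>r>0. \<forall>y\<in>carrier_vec d. vnorm (y - x) < r \<longrightarrow>
        \<bar>f y - f x - g \<bullet> (y - x)\<bar> \<le> e * vnorm (y - x))"

definition gradient :: "nat \<Rightarrow> (real vec \<Rightarrow> real) \<Rightarrow> real vec \<Rightarrow> real vec" where
  "gradient d f x = (THE g. has_gradient d f g x)"

definition smooth_fun :: "nat \<Rightarrow> real \<Rightarrow> (real vec \<Rightarrow> real) \<Rightarrow> bool" where
  "smooth_fun d \<beta> f \<longleftrightarrow>
     (\<forall>x\<in>carrier_vec d. \<exists>g. has_gradient d f g x) \<and>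
     (\<forall>x\<in>carrier_vec d. \<forall>y\<in>carrier_vec d.
        vnorm (gradient d f x - gradient d f y) \<le> \<beta> * vnorm (x - y))"

definition strongly_convex :: "nat \<Rightarrow> real \<Rightarrow> (real vec \<Rightarrow> real) \<Rightarrow> bool" where
  "strongly_convex d \<alpha> f \<longleftrightarrow>
     (\<forall>x\<in>carrier_vec d. \<forall>y\<in>carrier_vec d. \<forall>t\<in>{0..1}.
        f ((1 - t) \<cdot>\<^sub>v x + t \<cdot>\<^sub>v y)
          \<le> (1 - t) * f x + t * f y - \<alpha> / 2 * t * (1 - t) * (vnorm (x - y))\<^sup>2)"

text \<open>
  The supremum is taken in the reals, so this is the Fenchel conjugate only where that is finite;
  for a strongly convex \<open>f\<close> it is finite everywhere.
\<close>

definition fenchel_conjugate :: "nat \<Rightarrow> (real vec \<Rightarrow> real) \<Rightarrow> real vec \<Rightarrow> real" where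
  "fenchel_conjugate d f x = (SUP \<theta>\<in>carrier_vec d. x \<bullet> \<theta> - f \<theta>)"

definition avg_fun :: "nat \<Rightarrow> (nat \<Rightarrow> real vec \<Rightarrow> real) \<Rightarrow> real vec \<Rightarrow> real" where
  "avg_fun n f \<theta> = (1 / real n) * (\<Sum>i<n. f i \<theta>)"

subsection \<open>Gossip matrices\<close>

definition ones :: "nat \<Rightarrow> real vec" where
  "ones n = vec n (\<lambda>_. 1)"

definition gossip_matrix :: "nat \<Rightarrow> nat pair_pre_digraph \<Rightarrow> real mat \<Rightarrow> bool" where
  "gossip_matrix n G W \<longleftrightarrow>
     W \<in> carrier_mat n n \<and> transpose_mat W = W \<and>
     (\<forall>v\<in>carrier_vec n. v \<bullet> (W *\<^sub>v v) \<ge> 0) \<and>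
     mat_kernel W = {c \<cdot>\<^sub>v ones n |c. True} \<and>
     (\<forall>i<n. \<forall>j<n. W $$ (i, j) \<noteq> 0 \<longrightarrow> i = j \<or> (i, j) \<in> parcs G)"

text \<open>
  The real eigenvalues with algebraic multiplicity, in decreasing order; a symmetric matrix of
  size \<open>n\<close> has exactly \<open>n\<close> of them. \<open>nth_eigenvalue\<close> counts from \<open>1\<close>.
\<close>

definition eigenvalue_list :: "real mat \<Rightarrow> real list" where
  "eigenvalue_list W = rev (sorted_list_of_multiset (proots (char_poly W)))"

definition nth_eigenvalue :: "nat \<Rightarrow> real mat \<Rightarrow> real" where
  "nth_eigenvalue k W = eigenvalue_list W ! (k - 1)"

definition eigengap :: "nat \<Rightarrow> real mat \<Rightarrow> real" where
  "eigengap n W = nth_eigenvalue (n - 1) W / nth_eigenvalue 1 W"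

subsection \<open>Accelerated gossip\<close>

fun gossip_a :: "real \<Rightarrow> nat \<Rightarrow> real" where
  "gossip_a c2 0 = 1"
| "gossip_a c2 (Suc 0) = c2"
| "gossip_a c2 (Suc (Suc k)) = 2 * c2 * gossip_a c2 (Suc k) - gossip_a c2 k"

fun gossip_z :: "real \<Rightarrow> real mat \<Rightarrow> real mat \<Rightarrow> nat \<Rightarrow> real mat" where
  "gossip_z c2 M x 0 = x"
| "gossip_z c2 M x (Suc 0) = c2 \<cdot>\<^sub>m (x * M)"
| "gossip_z c2 M x (Suc (Suc k)) =
     (2 * c2) \<cdot>\<^sub>m (gossip_z c2 M x (Suc k) * M) - gossip_z c2 M x k"

definition acc_gossip :: "nat \<Rightarrow> real mat \<Rightarrow> real mat \<Rightarrow> nat \<Rightarrow> real mat" where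
  "acc_gossip n x W K =
     (let \<gamma> = eigengap n W;
          c2 = (1 + \<gamma>) / (1 - \<gamma>);
          c3 = 2 / ((1 + \<gamma>) * nth_eigenvalue 1 W)
      in x - (1 / gossip_a c2 K) \<cdot>\<^sub>m gossip_z c2 (1\<^sub>m n - c3 \<cdot>\<^sub>m W) x K)"

subsection \<open>The MSDA method\<close>

definition msda_K :: "real \<Rightarrow> nat" where
  "msda_K \<gamma> = nat \<lfloor>1 / sqrt \<gamma>\<rfloor>"

definition msda_c1 :: "real \<Rightarrow> real" where
  "msda_c1 \<gamma> = (1 - sqrt \<gamma>) / (1 + sqrt \<gamma>)"

definition msda_eta :: "real \<Rightarrow> real \<Rightarrow> real" where
  "msda_eta \<gamma> \<alpha> =
     (let c1 = msda_c1 \<gamma>; K = msda_K \<gamma> in \<alpha> * (1 + c1 ^ (2 * K)) / (1 + c1 ^ K)\<^sup>2)"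

definition msda_mu :: "real \<Rightarrow> real \<Rightarrow> real" where
  "msda_mu \<gamma> \<kappa> =
     (let c1 = msda_c1 \<gamma>; K = msda_K \<gamma>
      in ((1 + c1 ^ K) * sqrt \<kappa> - 1 + c1 ^ K) / ((1 + c1 ^ K) * sqrt \<kappa> + 1 - c1 ^ K))"

definition dual_gradients :: "nat \<Rightarrow> nat \<Rightarrow> (nat \<Rightarrow> real vec \<Rightarrow> real) \<Rightarrow> real mat \<Rightarrow> real mat" where
  "dual_gradients d n f x =
     mat_of_cols d (map (\<lambda>i. gradient d (fenchel_conjugate d (f i)) (col x i)) [0..<n])"

text \<open>The pair of iterates \<open>(x\<^sub>t, y\<^sub>t)\<close>.\<close>

primrec msda_state ::
  "nat \<Rightarrow> nat \<Rightarrow> real mat \<Rightarrow> (nat \<Rightarrow> real vec \<Rightarrow> real) \<Rightarrow> real \<Rightarrow> real \<Rightarrow> nat \<Rightarrow> real mat \<times> real mat"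
where
  "msda_state d n W f \<alpha> \<beta> 0 = (0\<^sub>m d n, 0\<^sub>m d n)"
| "msda_state d n W f \<alpha> \<beta> (Suc t) =
     (let (x, y) = msda_state d n W f \<alpha> \<beta> t;
          \<gamma> = eigengap n W;
          \<mu> = msda_mu \<gamma> (\<beta> / \<alpha>);
          y' = x - msda_eta \<gamma> \<alpha> \<cdot>\<^sub>m acc_gossip n (dual_gradients d n f x) W (msda_K \<gamma>);
          x' = (1 + \<mu>) \<cdot>\<^sub>m y' - \<mu> \<cdot>\<^sub>m y
      in (x', y'))"

definition msda_Theta ::
  "nat \<Rightarrow> nat \<Rightarrow> real mat \<Rightarrow> (nat \<Rightarrow> real vec \<Rightarrow> real) \<Rightarrow> real \<Rightarrow> real \<Rightarrow> nat \<Rightarrow> real mat" where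
  "msda_Theta d n W f \<alpha> \<beta> t = dual_gradients d n f (fst (msda_state d n W f \<alpha> \<beta> t))"

text \<open>
  The first iteration at which precision \<open>\<epsilon>\<close> is reached, times the cost of an iteration;
  \<open>\<infinity>\<close> if the precision is never reached.
\<close>

definition msda_time ::
  "nat \<Rightarrow> nat \<Rightarrow> real mat \<Rightarrow> (nat \<Rightarrow> real vec \<Rightarrow> real) \<Rightarrow> real \<Rightarrow> real \<Rightarrow> real \<Rightarrow> real vec \<Rightarrow> real \<Rightarrow> ereal"
where
  "msda_time d n W f \<alpha> \<beta> \<tau> \<theta>s \<epsilon> =
     (INF t\<in>{t. Max ((\<lambda>i. avg_fun n f (col (msda_Theta d n W f \<alpha> \<beta> t) i)) ` {..<n})
                  - avg_fun n f \<theta>s \<le> \<epsilon>}.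
        ereal (real t * (1 + real (msda_K (eigengap n W)) * \<tau>)))"

subsection \<open>Convergence of matrices\<close>

definition mat_tendsto :: "nat \<Rightarrow> nat \<Rightarrow> (nat \<Rightarrow> real mat) \<Rightarrow> real mat \<Rightarrow> bool" where
  "mat_tendsto d n X L \<longleftrightarrow> (\<forall>i<d. \<forall>j<n. (\<lambda>t. X t $$ (i, j)) \<longlonglongrightarrow> L $$ (i, j))"

end

theory Submission
  imports Defs "Jordan_Normal_Form.Schur_Decomposition"
begin

text \<open>
  MSDA is Nesterov's accelerated gradient method for a well-conditioned dual problem.

  Consensus is encoded by a positive semidefinite matrix whose kernel is spanned by the all-ones
  vector. The dual problem is to minimize \<open>\<Sum>k. f\<^sub>k\<^sup>*(x\<^sub>k)\<close> over the matrices \<open>x\<close> with zero row sums, and its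
  solution has the columns \<open>\<nabla>f\<^sub>k(\<theta>\<^sup>*)\<close>. Since \<open>f\<^sub>k\<close> is \<open>\<alpha>\<close>-strongly convex and \<open>\<beta>\<close>-smooth, its conjugate is
  differentiable with \<open>\<nabla>f\<^sub>k\<^sup>* = (\<nabla>f\<^sub>k)\<^sup>-\<^sup>1\<close>, is \<open>1/\<alpha>\<close>-smooth and is \<open>1/\<beta>\<close>-strongly convex
  (\<open>smooth_strongly_convex.conjugate_bounds\<close>).

  Accelerated gossip multiplies by a polynomial \<open>P\<close> in \<open>W\<close>, built from a Chebyshev polynomial. It has the kernel
  of \<open>W\<close>, and its other eigenvalues lie between \<open>(1 - c)\<^sup>2 / (1 + c\<^sup>2)\<close> and \<open>(1 + c)\<^sup>2 / (1 + c\<^sup>2)\<close> with \<open>c = c\<^sub>1\<^sup>K\<close>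
  (\<open>acc_gossip_spectrum\<close>). For this the eigenvalue list of \<open>W\<close>, defined by its characteristic polynomial,
  has to be related to an orthonormal eigenbasis (\<open>symmetric_orthogonal_diagonalization\<close>).

  Measure the dual variable in the norm given by the pseudo-inverse of \<open>P\<close>. In this norm, on the matrices with
  zero row sums, \<open>\<Theta> P\<close> is the gradient of the dual objective, which is smooth and strongly convex with
  condition number \<open>(\<beta>/\<alpha>) ((1 + c) / (1 - c))\<^sup>2\<close>, and the parameters of MSDA are exactly Nesterov's for these constants.
  In eigencoordinates \<open>P\<close> is diagonal and the norm is a weighted sum of squares. A standard energy
  then decays by a factor \<open>1 - q\<close> per iteration, where \<open>1/q\<close> is the square root of the condition number
  (\<open>accelerated_gradient_step\<close>, \<open>msda.energy_Suc\<close>). It dominates the squared distance of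
  the dual iterates to the solution, hence that of the primal iterates, because \<open>\<nabla>f\<^sub>k\<^sup>*\<close> is Lipschitz.

  Finally \<open>K\<close> is comparable to \<open>1/\<surd>\<gamma>\<close>, which makes \<open>c \<le> 1/2\<close> (\<open>msda_c1_power_le\<close>). Therefore \<open>1/q \<le> 3 \<surd>(\<beta>/\<alpha>)\<close>,
  while an iteration costs at most \<open>1 + \<tau>/\<surd>\<gamma>\<close>.
\<close>

section \<open>Euclidean geometry of coordinate vectors\<close>

lemma sprod_self_ge_0: "(v::real vec) \<bullet> v \<ge> 0"
  by (auto simp: scalar_prod_def intro!: sum_nonneg)

lemma vnorm_sq: "(vnorm v)\<^sup>2 = v \<bullet> v"
  by (simp add: vnorm_def sprod_self_ge_0)

lemma vnorm_nonneg [simp]: "vnorm v \<ge> 0"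
  by (simp add: vnorm_def sprod_self_ge_0)

lemma sprod_self_eq_0:
  assumes "v \<in> carrier_vec d" "(v::real vec) \<bullet> v = 0"
  shows "v = 0\<^sub>v d"
proof (rule eq_vecI)
  fix i assume i: "i < dim_vec (0\<^sub>v d :: real vec)"
  have "(\<Sum>a\<in>{0..<dim_vec v}. v $ a * v $ a) = 0"
    using assms by (simp add: scalar_prod_def)
  then have "\<forall>a\<in>{0..<dim_vec v}. v $ a * v $ a = 0"
    by (subst (asm) sum_nonneg_eq_0_iff) auto
  then show "v $ i = 0\<^sub>v d $ i" using i assms by auto
qed (use assms in auto)

lemma vnorm_smult: "vnorm (c \<cdot>\<^sub>v v) = \<bar>c\<bar> * vnorm v"
proof -
  have "(c \<cdot>\<^sub>v v) \<bullet> (c \<cdot>\<^sub>v v) = c\<^sup>2 * (v \<bullet> v)"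
    by (auto simp: scalar_prod_def sum_distrib_left power2_eq_square intro!: sum.cong)
  then show ?thesis by (simp add: vnorm_def real_sqrt_mult)
qed

lemma sprod_add_add:
  assumes "v \<in> carrier_vec d" "w \<in> carrier_vec d"
  shows "((v::real vec) + w) \<bullet> (v + w) = v \<bullet> v + 2 * (v \<bullet> w) + w \<bullet> w"
  using assms comm_scalar_prod[of w d v]
  by (simp add: scalar_prod_add_distrib[of _ d] add_scalar_prod_distrib[of _ d])

lemma sprod_minus_minus:
  assumes "v \<in> carrier_vec d" "w \<in> carrier_vec d"
  shows "((v::real vec) - w) \<bullet> (v - w) = v \<bullet> v - 2 * (v \<bullet> w) + w \<bullet> w"
  using assms comm_scalar_prod[of w d v]
  by (simp add: scalar_prod_minus_distrib[of _ d] minus_scalar_prod_distrib[of _ d])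

lemma sprod_Cauchy_Schwarz:
  assumes "v \<in> carrier_vec d" "w \<in> carrier_vec d"
  shows "(v::real vec) \<bullet> w \<le> vnorm v * vnorm w"
proof (cases "vnorm v = 0 \<or> vnorm w = 0")
  case True
  then have "v = 0\<^sub>v d \<or> w = 0\<^sub>v d"
    using sprod_self_eq_0 assms vnorm_sq by (metis zero_power2)
  then show ?thesis using assms by auto
next
  case False
  then have pos: "vnorm v > 0" "vnorm w > 0"
    using vnorm_nonneg by (metis less_eq_real_def)+
  have "0 \<le> (vnorm w \<cdot>\<^sub>v v - vnorm v \<cdot>\<^sub>v w) \<bullet> (vnorm w \<cdot>\<^sub>v v - vnorm v \<cdot>\<^sub>v w)"
    by (rule sprod_self_ge_0)
  also have "\<dots> = (vnorm w)\<^sup>2 * (v \<bullet> v) - 2 * vnorm v * vnorm w * (v \<bullet> w) + (vnorm v)\<^sup>2 * (w \<bullet> w)"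
    using assms by (subst sprod_minus_minus[of _ d]) (auto simp: power2_eq_square)
  also have "\<dots> = 2 * vnorm v * vnorm w * (vnorm v * vnorm w - v \<bullet> w)"
    by (simp add: vnorm_sq[symmetric] power2_eq_square algebra_simps)
  finally have "0 \<le> vnorm v * vnorm w - v \<bullet> w"
    using pos by (metis mult_pos_pos zero_less_numeral zero_le_mult_iff not_less)
  then show ?thesis by simp
qed

text \<open>
  The form of Cauchy-Schwarz that trades the two norms against each other; it is what turns
  strong convexity of a function into smoothness of its conjugate.
\<close>

lemma sprod_le_Young:
  assumes "v \<in> carrier_vec d" "w \<in> carrier_vec d" "c > 0"
  shows "(v::real vec) \<bullet> w \<le> c / 2 * (w \<bullet> w) + (v \<bullet> v) / (2 * c)"
proof -
  have "0 \<le> (c \<cdot>\<^sub>v w - v) \<bullet> (c \<cdot>\<^sub>v w - v)"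
    by (rule sprod_self_ge_0)
  also have "\<dots> = c\<^sup>2 * (w \<bullet> w) - 2 * c * (v \<bullet> w) + v \<bullet> v"
    using assms comm_scalar_prod[of w d v]
    by (subst sprod_minus_minus[of _ d]) (auto simp: power2_eq_square)
  finally show ?thesis using assms(3) by (simp add: field_simps power2_eq_square)
qed

lemma vnorm_triangle:
  assumes "v \<in> carrier_vec d" "w \<in> carrier_vec d"
  shows "vnorm (v + w) \<le> vnorm v + vnorm w"
proof (rule power2_le_imp_le)
  show "(vnorm (v + w))\<^sup>2 \<le> (vnorm v + vnorm w)\<^sup>2"
    using sprod_Cauchy_Schwarz[OF assms] sprod_add_add[OF assms]
    by (simp add: power2_sum vnorm_sq)
qed simp

lemma abs_index_le_vnorm:
  assumes "i < dim_vec v"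
  shows "\<bar>v $ i\<bar> \<le> vnorm v"
proof -
  have "(v $ i)\<^sup>2 \<le> v \<bullet> v"
    using assms unfolding scalar_prod_def power2_eq_square
    by (intro member_le_sum) auto
  then show ?thesis
    by (metis real_sqrt_abs real_sqrt_le_iff vnorm_def)
qed

lemma vec_minus_add_cancel:
  assumes "x \<in> carrier_vec d" "y \<in> carrier_vec d"
  shows "x + (y - x) = (y::real vec)"
  using assms by auto

lemma vnorm_minus_commute:
  assumes "x \<in> carrier_vec d" "y \<in> carrier_vec d"
  shows "vnorm (x - y) = vnorm (y - x)"
  using sprod_minus_minus[of x d y] sprod_minus_minus[of y d x] assms comm_scalar_prod[of x d y]
  by (simp add: vnorm_def)

section \<open>Gradients of smooth and strongly convex functions\<close>

lemma has_gradient_carrier: "has_gradient d f g x \<Longrightarrow> g \<in> carrier_vec d"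
  by (simp add: has_gradient_def)

text \<open>
  Needed because \<open>gradient\<close> is a definite description. Testing both candidates in the direction
  of their difference \<open>w\<close> gives \<open>\<parallel>w\<parallel>\<^sup>2 \<le> 2 e \<parallel>w\<parallel>\<close> for every \<open>e > 0\<close>.
\<close>

lemma has_gradient_unique:
  assumes x: "x \<in> carrier_vec d" and g: "has_gradient d f g x" and h: "has_gradient d f h x"
  shows "g = h"
proof -
  define w where "w = g - h"
  have gc: "g \<in> carrier_vec d" "h \<in> carrier_vec d" and wc: "w \<in> carrier_vec d"
    using g h by (auto simp: has_gradient_def w_def)
  have small: "vnorm w \<le> 2 * e" if e: "e > 0" for e
  proof (cases "vnorm w = 0")
    case True then show ?thesis using e by simp
  next
    case False
    then have wpos: "vnorm w > 0" using vnorm_nonneg less_eq_real_def by metis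
    obtain r where r: "r > 0" "\<And>y. y \<in> carrier_vec d \<Longrightarrow> vnorm (y - x) < r \<Longrightarrow>
        \<bar>f y - f x - g \<bullet> (y - x)\<bar> \<le> e * vnorm (y - x)"
      using g e unfolding has_gradient_def by blast
    obtain s where s: "s > 0" "\<And>y. y \<in> carrier_vec d \<Longrightarrow> vnorm (y - x) < s \<Longrightarrow>
        \<bar>f y - f x - h \<bullet> (y - x)\<bar> \<le> e * vnorm (y - x)"
      using h e unfolding has_gradient_def by blast
    define t where "t = min r s / (2 * vnorm w)"
    have t: "t > 0" "t * vnorm w < r" "t * vnorm w < s"
      using r(1) s(1) wpos by (auto simp: t_def min_def)
    define y where "y = x + t \<cdot>\<^sub>v w"
    have y: "y \<in> carrier_vec d" "y - x = t \<cdot>\<^sub>v w"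
      using x wc by (auto simp: y_def)
    have n: "vnorm (y - x) = t * vnorm w" using y t by (simp add: vnorm_smult)
    have "\<bar>g \<bullet> (y - x) - h \<bullet> (y - x)\<bar> \<le> 2 * e * (t * vnorm w)"
      using r(2)[OF y(1)] s(2)[OF y(1)] n t by auto
    moreover have "g \<bullet> (y - x) - h \<bullet> (y - x) = t * (vnorm w)\<^sup>2"
      using y(2) gc wc
      by (simp add: vnorm_sq w_def minus_scalar_prod_distrib[of _ d] algebra_simps)
    ultimately have "(t * vnorm w) * vnorm w \<le> (t * vnorm w) * (2 * e)"
      using t wpos by (simp add: power2_eq_square mult_ac)
    then show ?thesis using t wpos by simp
  qed
  have "vnorm w \<le> 0"
    by (rule field_le_epsilon) (use small[of "_ / 2"] in auto)
  then have "w \<bullet> w = 0"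
    using vnorm_nonneg[of w] vnorm_sq[of w] by simp
  then have "w = 0\<^sub>v d" using sprod_self_eq_0 wc by blast
  then have "\<And>i. i < d \<Longrightarrow> g $ i - h $ i = 0"
    using gc unfolding w_def by (metis index_minus_vec(1) index_zero_vec(1) carrier_vecD)
  then show ?thesis using gc by (intro eq_vecI) auto
qed

lemma gradient_eqI:
  assumes "x \<in> carrier_vec d" "has_gradient d f g x"
  shows "gradient d f x = g"
  unfolding gradient_def using assms has_gradient_unique by blast

lemma has_gradient_imp_DERIV_line:
  assumes x: "x \<in> carrier_vec d" and v: "v \<in> carrier_vec d"
    and g: "has_gradient d f g (x + t \<cdot>\<^sub>v v)"
  shows "((\<lambda>s. f (x + s \<cdot>\<^sub>v v)) has_real_derivative (g \<bullet> v)) (at t)"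
proof -
  have gc: "g \<in> carrier_vec d" using g by (rule has_gradient_carrier)
  define p where "p = x + t \<cdot>\<^sub>v v"
  have diff: "(x + s \<cdot>\<^sub>v v) - p = (s - t) \<cdot>\<^sub>v v" for s
    using x v by (auto simp: p_def algebra_simps)
  show ?thesis unfolding has_field_derivative_iff
  proof (rule LIM_I)
    fix e :: real assume e: "e > 0"
    define e' where "e' = e / (2 * (vnorm v + 1))"
    have "e' * (2 * (vnorm v + 1)) = e"
    proof -
      have "2 * (vnorm v + 1) > 0" by (intro mult_pos_pos add_nonneg_pos) auto
      then show ?thesis unfolding e'_def by (metis less_irrefl nonzero_eq_divide_eq)
    qed
    moreover have "e' > 0" unfolding e'_def using e vnorm_nonneg[of v] by (intro divide_pos_pos mult_pos_pos add_nonneg_pos) auto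
    moreover have "e' * vnorm v \<ge> 0" using \<open>e' > 0\<close> by simp
    moreover have "e' * (2 * (vnorm v + 1)) = 2 * (e' * vnorm v) + 2 * e'" by (simp add: algebra_simps)
    ultimately have e': "e' > 0" "e' * vnorm v < e" by linarith+
    obtain r where r: "r > 0" "\<And>y. y \<in> carrier_vec d \<Longrightarrow> vnorm (y - p) < r \<Longrightarrow>
        \<bar>f y - f p - g \<bullet> (y - p)\<bar> \<le> e' * vnorm (y - p)"
      using g e' unfolding has_gradient_def p_def by blast
    define \<delta> where "\<delta> = r / (vnorm v + 1)"
    have \<delta>: "\<delta> > 0" using r(1) vnorm_nonneg[of v] by (auto simp: \<delta>_def add_nonneg_pos)
    show "\<exists>\<delta>>0. \<forall>s. s \<noteq> t \<and> norm (s - t) < \<delta> \<longrightarrow>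
       norm ((f (x + s \<cdot>\<^sub>v v) - f (x + t \<cdot>\<^sub>v v)) / (s - t) - g \<bullet> v) < e"
    proof (intro exI conjI allI impI)
      fix s assume s: "s \<noteq> t \<and> norm (s - t) < \<delta>"
      then have "\<bar>s - t\<bar> * (vnorm v + 1) < r"
        using vnorm_nonneg[of v] by (simp add: \<delta>_def pos_less_divide_eq add_nonneg_pos)
      then have lt: "\<bar>s - t\<bar> * vnorm v < r" using abs_ge_zero[of "s - t"] unfolding distrib_left mult_1_right by linarith
      have "\<bar>f (x + s \<cdot>\<^sub>v v) - f p - (s - t) * (g \<bullet> v)\<bar> \<le> e' * (\<bar>s - t\<bar> * vnorm v)"
        using r(2)[of "x + s \<cdot>\<^sub>v v"] x v gc lt by (simp add: diff vnorm_smult)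
      then have "\<bar>(f (x + s \<cdot>\<^sub>v v) - f p - (s - t) * (g \<bullet> v)) / (s - t)\<bar> \<le> e' * vnorm v"
        using s by (simp add: divide_le_eq mult_ac)
      also have "(f (x + s \<cdot>\<^sub>v v) - f p - (s - t) * (g \<bullet> v)) / (s - t)
          = (f (x + s \<cdot>\<^sub>v v) - f p) / (s - t) - g \<bullet> v"
        using s by (simp add: diff_divide_distrib)
      finally show "norm ((f (x + s \<cdot>\<^sub>v v) - f (x + t \<cdot>\<^sub>v v)) / (s - t) - g \<bullet> v) < e"
        using e' by (simp add: p_def)
    qed (use \<delta> in auto)
  qed
qed

lemma smooth_fun_has_gradient:
  assumes "smooth_fun d \<beta> f" "x \<in> carrier_vec d"
  shows "has_gradient d f (gradient d f x) x"
  using assms gradient_eqI unfolding smooth_fun_def by metis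

lemma gradient_carrier:
  assumes "smooth_fun d \<beta> f" "x \<in> carrier_vec d"
  shows "gradient d f x \<in> carrier_vec d"
  using smooth_fun_has_gradient[OF assms] has_gradient_carrier by blast

text \<open>
  The descent lemma. Along the segment from \<open>x\<close> to \<open>y\<close>, the function minus the claimed upper
  bound has a derivative that is nonpositive by the Lipschitz condition.
\<close>

lemma smooth_fun_upper_bound:
  assumes f: "smooth_fun d \<beta> f" and x: "x \<in> carrier_vec d" and y: "y \<in> carrier_vec d"
  shows "f y \<le> f x + gradient d f x \<bullet> (y - x) + \<beta> / 2 * ((y - x) \<bullet> (y - x))"
proof -
  define v where "v = y - x"
  have v: "v \<in> carrier_vec d" using x y by (simp add: v_def)
  define \<phi> where "\<phi> t = f (x + t \<cdot>\<^sub>v v) - t * (gradient d f x \<bullet> v) - \<beta> / 2 * t\<^sup>2 * (v \<bullet> v)" for t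
  have c: "x + t \<cdot>\<^sub>v v \<in> carrier_vec d" for t using x v by simp
  have "\<phi> 1 \<le> \<phi> 0"
  proof (rule DERIV_nonpos_imp_nonincreasing[where f = \<phi> and a = 0 and b = 1])
    fix t :: real assume t: "0 \<le> t" "t \<le> 1"
    let ?D = "gradient d f (x + t \<cdot>\<^sub>v v) \<bullet> v - gradient d f x \<bullet> v - \<beta> * t * (v \<bullet> v)"
    have "(\<phi> has_real_derivative ?D) (at t)"
      unfolding \<phi>_def
      by (rule derivative_eq_intros has_gradient_imp_DERIV_line[OF x v smooth_fun_has_gradient[OF f c]]
           refl | simp add: power2_eq_square)+
    moreover have "?D \<le> 0"
    proof -
      have "gradient d f (x + t \<cdot>\<^sub>v v) \<bullet> v - gradient d f x \<bullet> v
          = (gradient d f (x + t \<cdot>\<^sub>v v) - gradient d f x) \<bullet> v"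
        using gradient_carrier[OF f] c x v by (simp add: minus_scalar_prod_distrib[of _ d])
      also have "\<dots> \<le> vnorm (gradient d f (x + t \<cdot>\<^sub>v v) - gradient d f x) * vnorm v"
        using gradient_carrier[OF f] c x v by (intro sprod_Cauchy_Schwarz[of _ d]) auto
      also have "\<dots> \<le> (\<beta> * vnorm ((x + t \<cdot>\<^sub>v v) - x)) * vnorm v"
        using f c x unfolding smooth_fun_def by (intro mult_right_mono) auto
      also have "(x + t \<cdot>\<^sub>v v) - x = t \<cdot>\<^sub>v v" using x v by auto
      finally show ?thesis using t by (simp add: vnorm_smult vnorm_sq[symmetric] power2_eq_square)
    qed
    ultimately show "\<exists>D. DERIV \<phi> t :> D \<and> D \<le> 0" by blast
  qed simp
  moreover have "x + 1 \<cdot>\<^sub>v v = y" "x + 0 \<cdot>\<^sub>v v = x" using x y by (auto simp: v_def)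
  ultimately show ?thesis by (simp add: \<phi>_def v_def)
qed

text \<open>
  The definition bounds the difference quotient of \<open>f\<close> along the segment from \<open>x\<close> to \<open>y\<close>; let the
  parameter tend to \<open>0\<close>.
\<close>

lemma strongly_convex_lower_bound:
  assumes f: "strongly_convex d \<alpha> f" and g: "has_gradient d f g x"
    and x: "x \<in> carrier_vec d" and y: "y \<in> carrier_vec d"
  shows "f y \<ge> f x + g \<bullet> (y - x) + \<alpha> / 2 * ((y - x) \<bullet> (y - x))"
proof -
  define v where "v = y - x"
  have v: "v \<in> carrier_vec d" using x y by (simp add: v_def)
  have zero_smult: "x + 0 \<cdot>\<^sub>v v = x" using x v by auto
  have "((\<lambda>s. f (x + s \<cdot>\<^sub>v v)) has_real_derivative (g \<bullet> v)) (at 0)"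
    by (rule has_gradient_imp_DERIV_line[OF x v]) (use g zero_smult in simp)
  then have "((\<lambda>t. (f (x + t \<cdot>\<^sub>v v) - f x) / t) \<longlongrightarrow> g \<bullet> v) (at 0)"
    using x v zero_smult by (simp add: has_field_derivative_iff)
  then have lim1: "((\<lambda>t. (f (x + t \<cdot>\<^sub>v v) - f x) / t) \<longlongrightarrow> g \<bullet> v) (at_right 0)"
    using filterlim_mono[OF _ order_refl] at_le by blast
  have lim2: "((\<lambda>t. f y - f x - \<alpha> / 2 * (1 - t) * (v \<bullet> v)) \<longlongrightarrow>
      f y - f x - \<alpha> / 2 * (1 - 0) * (v \<bullet> v)) (at_right (0::real))"
    by (intro tendsto_intros)
  have "g \<bullet> v \<le> f y - f x - \<alpha> / 2 * (1 - 0) * (v \<bullet> v)"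
  proof (rule tendsto_le[OF _ lim2 lim1])
    have "eventually (\<lambda>t::real. t \<in> {0<..<1}) (at_right 0)"
      by (rule eventually_at_right_real) simp
    then show "eventually (\<lambda>t. (f (x + t \<cdot>\<^sub>v v) - f x) / t \<le> f y - f x - \<alpha> / 2 * (1 - t) * (v \<bullet> v))
        (at_right 0)"
    proof (rule eventually_mono)
      fix t :: real assume t: "t \<in> {0<..<1}"
      have "x + t \<cdot>\<^sub>v v = (1 - t) \<cdot>\<^sub>v x + t \<cdot>\<^sub>v y"
        using x y by (auto simp: v_def algebra_simps)
      then have "f (x + t \<cdot>\<^sub>v v) \<le> (1 - t) * f x + t * f y - \<alpha> / 2 * t * (1 - t) * (vnorm (x - y))\<^sup>2"
        using f x y t unfolding strongly_convex_def by auto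
      also have "vnorm (x - y) = vnorm v" using vnorm_minus_commute[OF x y] by (simp add: v_def)
      finally have "f (x + t \<cdot>\<^sub>v v) - f x \<le> t * (f y - f x - \<alpha> / 2 * (1 - t) * (v \<bullet> v))"
        by (simp add: vnorm_sq algebra_simps)
      then show "(f (x + t \<cdot>\<^sub>v v) - f x) / t \<le> f y - f x - \<alpha> / 2 * (1 - t) * (v \<bullet> v)"
        using t by (simp add: divide_le_eq mult.commute)
    qed
  qed simp
  then show ?thesis by (simp add: v_def)
qed

section \<open>The conjugate of a smooth strongly convex function\<close>

text \<open>
  Completeness of \<open>R^d\<close> for the carrier-based vectors, in the geometric form that a contraction
  produces; it reduces to completeness of the reals in each coordinate.
\<close>

lemma cauchy_vec_converges:
  fixes u :: "nat \<Rightarrow> real vec"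
  assumes u: "\<And>k. u k \<in> carrier_vec d" and r: "0 \<le> r" "r < 1"
    and step: "\<And>k. vnorm (u (Suc k) - u k) \<le> c * r ^ k"
  obtains l where "l \<in> carrier_vec d" "(\<lambda>k. vnorm (u k - l)) \<longlonglongrightarrow> 0"
proof -
  have conv: "convergent (\<lambda>k. u k $ i)" if i: "i < d" for i
  proof -
    have bnd: "norm (u (Suc k) $ i - u k $ i) \<le> c * r ^ k" for k
    proof -
      have "u (Suc k) $ i - u k $ i = (u (Suc k) - u k) $ i"
        using u[of k] i by simp
      also have "\<bar>\<dots>\<bar> \<le> vnorm (u (Suc k) - u k)"
        by (rule abs_index_le_vnorm) (use u[of k] i in simp)
      also have "\<dots> \<le> c * r ^ k" by (rule step)
      finally show ?thesis by simp
    qed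
    have "summable (\<lambda>k. c * r ^ k)" using r by (intro summable_mult summable_geometric) simp
    then have "summable (\<lambda>k. u (Suc k) $ i - u k $ i)"
      by (rule summable_comparison_test') (rule bnd)
    then have "convergent (\<lambda>k. \<Sum>j<k. u (Suc j) $ i - u j $ i)"
      unfolding summable_iff_convergent .
    then have "convergent (\<lambda>k. u k $ i - u 0 $ i)"
      unfolding sum_lessThan_telescope[of "\<lambda>k. u k $ i"] .
    then have "convergent (\<lambda>k. (u k $ i - u 0 $ i) + u 0 $ i)"
      by (rule convergent_add) (rule convergent_const)
    then show ?thesis by simp
  qed
  define l where "l = vec d (\<lambda>i. lim (\<lambda>k. u k $ i))"
  have l: "l \<in> carrier_vec d" by (simp add: l_def)
  have "(\<lambda>k. u k $ i) \<longlonglongrightarrow> l $ i" if "i < d" for i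
    using conv[OF that, unfolded convergent_LIMSEQ_iff] that unfolding l_def by simp
  then have "(\<lambda>k. sqrt (\<Sum>i\<in>{0..<d}. (u k $ i - l $ i) * (u k $ i - l $ i)))
      \<longlonglongrightarrow> sqrt (\<Sum>i\<in>{0..<d}. (l $ i - l $ i) * (l $ i - l $ i))"
    by (intro tendsto_intros) auto
  moreover have "vnorm (u k - l) = sqrt (\<Sum>i\<in>{0..<d}. (u k $ i - l $ i) * (u k $ i - l $ i))" for k
    using u[of k] l by (simp add: vnorm_def scalar_prod_def)
  ultimately show thesis using that[OF l] by simp
qed

locale smooth_strongly_convex =
  fixes d :: nat and f :: "real vec \<Rightarrow> real" and \<alpha> \<beta> :: real
  assumes \<alpha>_pos: "0 < \<alpha>" and \<alpha>_le_\<beta>: "\<alpha> \<le> \<beta>"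
    and strongly_convex: "strongly_convex d \<alpha> f" and smooth: "smooth_fun d \<beta> f"
begin

lemma \<beta>_pos: "0 < \<beta>" using \<alpha>_pos \<alpha>_le_\<beta> by linarith

lemmas grad_carrier = gradient_carrier[OF smooth]
  and upper_bound = smooth_fun_upper_bound[OF smooth]
  and lower_bound = strongly_convex_lower_bound[OF strongly_convex smooth_fun_has_gradient[OF smooth]]

lemma grad_Lipschitz:
  "x \<in> carrier_vec d \<Longrightarrow> y \<in> carrier_vec d \<Longrightarrow>
    vnorm (gradient d f x - gradient d f y) \<le> \<beta> * vnorm (x - y)"
  using smooth unfolding smooth_fun_def by blast

lemma grad_strongly_monotone:
  assumes x: "x \<in> carrier_vec d" and y: "y \<in> carrier_vec d"
  shows "\<alpha> * ((x - y) \<bullet> (x - y)) \<le> (gradient d f x - gradient d f y) \<bullet> (x - y)"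
proof -
  define gx gy where "gx = gradient d f x" and "gy = gradient d f y"
  have g: "gx \<in> carrier_vec d" "gy \<in> carrier_vec d" using grad_carrier x y by (auto simp: gx_def gy_def)
  have neg: "y - x = (- 1) \<cdot>\<^sub>v (x - y)" using x y by auto
  have "(y - x) \<bullet> (y - x) = (x - y) \<bullet> (x - y)" "gx \<bullet> (y - x) = - (gx \<bullet> (x - y))"
    unfolding neg using g x y by simp_all
  moreover have "(gx - gy) \<bullet> (x - y) = gx \<bullet> (x - y) - gy \<bullet> (x - y)"
    using g x y by (simp add: minus_scalar_prod_distrib[of _ d])
  ultimately show ?thesis
    using lower_bound[OF x x y] lower_bound[OF y y x] by (simp add: gx_def gy_def)
qed

text \<open>
  The gradient of \<open>f\<close> is strongly monotone and Lipschitz, so \<open>\<theta> \<mapsto> \<theta> - s (\<nabla>f(\<theta>) - x)\<close> is a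
  contraction for small \<open>s\<close>, and its fixed points are the solutions of \<open>\<nabla>f(\<theta>) = x\<close>.
\<close>

lemma grad_surj:
  assumes x: "x \<in> carrier_vec d"
  shows "\<exists>\<theta>\<in>carrier_vec d. gradient d f \<theta> = x"
proof -
  \<comment> \<open>This \<open>s\<close> minimizes the squared contraction factor \<open>1 - 2 s \<alpha> + s\<^sup>2 \<beta>\<^sup>2\<close>.\<close>
  define s where "s = \<alpha> / \<beta>\<^sup>2"
  define r where "r = sqrt (1 - \<alpha>\<^sup>2 / \<beta>\<^sup>2)"
  have s: "s > 0" using \<alpha>_pos \<beta>_pos by (simp add: s_def)
  have "\<alpha>\<^sup>2 \<le> \<beta>\<^sup>2" using \<alpha>_pos \<alpha>_le_\<beta> by (intro power_mono) auto
  then have "\<alpha>\<^sup>2 / \<beta>\<^sup>2 \<le> 1" "\<alpha>\<^sup>2 / \<beta>\<^sup>2 > 0" using \<alpha>_pos \<beta>_pos by simp_all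
  then have r: "0 \<le> r" "r < 1" and r2: "r\<^sup>2 = 1 - \<alpha>\<^sup>2 / \<beta>\<^sup>2" by (auto simp: r_def)
  define T where "T \<theta> = \<theta> - s \<cdot>\<^sub>v (gradient d f \<theta> - x)" for \<theta>
  have Tc: "T \<theta> \<in> carrier_vec d" if "\<theta> \<in> carrier_vec d" for \<theta>
    using that x grad_carrier by (simp add: T_def)
  have contr: "vnorm (T a - T b) \<le> r * vnorm (a - b)"
    if a: "a \<in> carrier_vec d" and b: "b \<in> carrier_vec d" for a b
  proof (rule power2_le_imp_le)
    define g where "g = gradient d f a - gradient d f b"
    have g: "g \<in> carrier_vec d" "a - b \<in> carrier_vec d"
      using grad_carrier a b by (auto simp: g_def)
    have "T a - T b = (a - b) - s \<cdot>\<^sub>v g"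
      using a b x grad_carrier[OF a] grad_carrier[OF b]
      by (intro eq_vecI) (simp_all add: T_def g_def algebra_simps)
    then have "(vnorm (T a - T b))\<^sup>2 = (a - b) \<bullet> (a - b) - 2 * s * (g \<bullet> (a - b)) + s\<^sup>2 * (g \<bullet> g)"
      using g comm_scalar_prod[OF g]
      unfolding vnorm_sq by (simp add: sprod_minus_minus[of _ d] power2_eq_square)
    also have "\<dots> \<le> (a - b) \<bullet> (a - b) - 2 * s * (\<alpha> * ((a - b) \<bullet> (a - b)))
        + s\<^sup>2 * (\<beta>\<^sup>2 * ((a - b) \<bullet> (a - b)))"
    proof -
      have "(vnorm g)\<^sup>2 \<le> (\<beta> * vnorm (a - b))\<^sup>2"
        unfolding g_def by (rule power_mono[OF grad_Lipschitz[OF a b]]) simp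
      then have "g \<bullet> g \<le> \<beta>\<^sup>2 * ((a - b) \<bullet> (a - b))" by (simp add: power_mult_distrib vnorm_sq)
      then have "s\<^sup>2 * (g \<bullet> g) \<le> s\<^sup>2 * (\<beta>\<^sup>2 * ((a - b) \<bullet> (a - b)))" by (intro mult_left_mono) auto
      moreover have "2 * s * (\<alpha> * ((a - b) \<bullet> (a - b))) \<le> 2 * s * (g \<bullet> (a - b))"
        using grad_strongly_monotone[OF a b] s by (intro mult_left_mono) (auto simp: g_def)
      ultimately show ?thesis by linarith
    qed
    also have "\<dots> = (r * vnorm (a - b))\<^sup>2"
    proof -
      have "2 * s * \<alpha> = 2 * (\<alpha>\<^sup>2 / \<beta>\<^sup>2)" "s\<^sup>2 * \<beta>\<^sup>2 = \<alpha>\<^sup>2 / \<beta>\<^sup>2"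
        using \<beta>_pos by (simp_all add: s_def power2_eq_square)
      then have "1 - 2 * s * \<alpha> + s\<^sup>2 * \<beta>\<^sup>2 = r\<^sup>2" by (simp add: r2)
      then have "(1 - 2 * s * \<alpha> + s\<^sup>2 * \<beta>\<^sup>2) * ((a - b) \<bullet> (a - b)) = r\<^sup>2 * ((a - b) \<bullet> (a - b))" by simp
      then show ?thesis by (simp add: vnorm_sq algebra_simps)
    qed
    finally show "(vnorm (T a - T b))\<^sup>2 \<le> (r * vnorm (a - b))\<^sup>2" .
  qed (use r in simp)
  define u where "u k = (T ^^ k) (0\<^sub>v d)" for k
  have u: "u k \<in> carrier_vec d" for k unfolding u_def by (induction k) (simp_all add: Tc)
  have uS: "u (Suc k) = T (u k)" for k by (simp add: u_def)
  have step: "vnorm (u (Suc k) - u k) \<le> vnorm (u 1 - u 0) * r ^ k" for k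
  proof (induction k)
    case (Suc k)
    have "vnorm (u (Suc (Suc k)) - u (Suc k)) \<le> r * vnorm (u (Suc k) - u k)"
      using contr[OF u u, of "Suc k" k] by (simp add: uS)
    also have "\<dots> \<le> r * (vnorm (u 1 - u 0) * r ^ k)" using Suc r by (intro mult_left_mono)
    finally show ?case by (simp add: mult_ac)
  qed simp
  obtain l where l: "l \<in> carrier_vec d" and lim: "(\<lambda>k. vnorm (u k - l)) \<longlonglongrightarrow> 0"
    using cauchy_vec_converges[OF u r step] .
  have bound: "vnorm (gradient d f l - x) \<le> \<beta> * vnorm (u k - l) + (vnorm (u 1 - u 0) * r ^ k) / s" for k
  proof -
    note gc = grad_carrier[OF l] grad_carrier[OF u[of k]]
    have "u (Suc k) - u k = (- s) \<cdot>\<^sub>v (gradient d f (u k) - x)"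
      using u[of k] gc(2) x by (intro eq_vecI) (simp_all add: uS T_def algebra_simps)
    then have eq: "vnorm (gradient d f (u k) - x) = vnorm (u (Suc k) - u k) / s"
      using s by (simp add: vnorm_smult)
    have "gradient d f l - x = (gradient d f l - gradient d f (u k)) + (gradient d f (u k) - x)"
      using gc x by auto
    then have "vnorm (gradient d f l - x)
        \<le> vnorm (gradient d f l - gradient d f (u k)) + vnorm (gradient d f (u k) - x)"
      using gc x vnorm_triangle[of "gradient d f l - gradient d f (u k)" d "gradient d f (u k) - x"] by simp
    also have "vnorm (gradient d f l - gradient d f (u k)) \<le> \<beta> * vnorm (l - u k)"
      by (rule grad_Lipschitz[OF l u])
    also have "vnorm (l - u k) = vnorm (u k - l)" by (rule vnorm_minus_commute[OF l u])
    also have "vnorm (gradient d f (u k) - x) \<le> (vnorm (u 1 - u 0) * r ^ k) / s"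
      unfolding eq using step[of k] s by (intro divide_right_mono) auto
    finally show ?thesis by simp
  qed
  have "(\<lambda>k. \<beta> * vnorm (u k - l) + (vnorm (u 1 - u 0) * r ^ k) / s)
      \<longlonglongrightarrow> \<beta> * 0 + (vnorm (u 1 - u 0) * 0) / s"
    using s by (intro tendsto_add tendsto_mult_left tendsto_divide lim LIMSEQ_realpow_zero[OF r] tendsto_const) simp
  then have "vnorm (gradient d f l - x) \<le> \<beta> * 0 + (vnorm (u 1 - u 0) * 0) / s"
    by (rule LIMSEQ_le_const) (use bound in blast)
  then have "(gradient d f l - x) \<bullet> (gradient d f l - x) = 0"
    using vnorm_nonneg[of "gradient d f l - x"] vnorm_sq[of "gradient d f l - x"] by simp
  then have "gradient d f l - x = 0\<^sub>v d"
    by (rule sprod_self_eq_0[OF minus_carrier_vec[OF grad_carrier[OF l] x]])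
  then have "gradient d f l = x"
    using grad_carrier[OF l] x vec_minus_add_cancel[OF x grad_carrier[OF l]] by simp
  then show ?thesis using l by blast
qed

definition grad_inv :: "real vec \<Rightarrow> real vec" where
  "grad_inv x = (SOME \<theta>. \<theta> \<in> carrier_vec d \<and> gradient d f \<theta> = x)"

lemma grad_inv:
  assumes "x \<in> carrier_vec d"
  shows "grad_inv x \<in> carrier_vec d" "gradient d f (grad_inv x) = x"
proof -
  have "\<exists>\<theta>. \<theta> \<in> carrier_vec d \<and> gradient d f \<theta> = x" using grad_surj[OF assms] by blast
  from someI_ex[OF this] show "grad_inv x \<in> carrier_vec d" "gradient d f (grad_inv x) = x"
    unfolding grad_inv_def by auto
qed

text \<open>
  The concave function \<open>\<theta> \<mapsto> x \<bullet> \<theta> - f \<theta>\<close> is maximal where its gradient vanishes. This makes the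
  supremum in the conjugate an attained maximum.
\<close>

lemma fenchel_young:
  assumes x: "x \<in> carrier_vec d" and \<theta>: "\<theta> \<in> carrier_vec d"
  shows "x \<bullet> \<theta> - f \<theta> \<le> x \<bullet> grad_inv x - f (grad_inv x)"
proof -
  note g = grad_inv[OF x]
  have "f (grad_inv x) + x \<bullet> (\<theta> - grad_inv x) \<le> f \<theta>"
  proof -
    have "\<alpha> / 2 * ((\<theta> - grad_inv x) \<bullet> (\<theta> - grad_inv x)) \<ge> 0"
      using sprod_self_ge_0 \<alpha>_pos by (intro mult_nonneg_nonneg) auto
    then show ?thesis using lower_bound[OF g(1) g(1) \<theta>] unfolding g(2) by linarith
  qed
  then show ?thesis using x \<theta> g by (simp add: scalar_prod_minus_distrib[of _ d])
qed

lemma fenchel_conjugate_eq: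
  assumes x: "x \<in> carrier_vec d"
  shows "fenchel_conjugate d f x = x \<bullet> grad_inv x - f (grad_inv x)"
  unfolding fenchel_conjugate_def
  by (rule cSup_eq_maximum) (use grad_inv[OF x] fenchel_young[OF x] in auto)

text \<open>
  Smoothness of the conjugate: the strong convexity bound for \<open>f\<close> at \<open>grad_inv x\<close>, conjugated
  by Young's inequality.
\<close>

lemma conjugate_upper_grad_inv:
  assumes x: "x \<in> carrier_vec d" and y: "y \<in> carrier_vec d"
  shows "fenchel_conjugate d f y \<le> fenchel_conjugate d f x + grad_inv x \<bullet> (y - x)
           + ((y - x) \<bullet> (y - x)) / (2 * \<alpha>)"
proof -
  define a b where "a = grad_inv x" and "b = grad_inv y"
  have a: "a \<in> carrier_vec d" "gradient d f a = x" and b: "b \<in> carrier_vec d"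
    using grad_inv x y by (auto simp: a_def b_def)
  have l: "f b \<ge> f a + x \<bullet> (b - a) + \<alpha> / 2 * ((b - a) \<bullet> (b - a))"
    using lower_bound[OF a(1) a(1) b] a by simp
  have Y: "(y - x) \<bullet> (b - a) \<le> \<alpha> / 2 * ((b - a) \<bullet> (b - a)) + ((y - x) \<bullet> (y - x)) / (2 * \<alpha>)"
    by (rule sprod_le_Young[of _ d]) (use a b x y \<alpha>_pos in auto)
  have "y \<bullet> b - f b - (x \<bullet> a - f a) - a \<bullet> (y - x) = (y - x) \<bullet> (b - a) - (f b - f a - x \<bullet> (b - a))"
    using a b x y comm_scalar_prod[OF a(1) x] comm_scalar_prod[OF a(1) y]
    by (simp add: scalar_prod_minus_distrib[of _ d] minus_scalar_prod_distrib[of _ d])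
  then show ?thesis using l Y x y by (simp add: fenchel_conjugate_eq a_def[symmetric] b_def[symmetric])
qed

text \<open>
  Strong convexity of the conjugate: use as competitor in the supremum at \<open>y\<close> the maximizer at \<open>x\<close>
  shifted by \<open>(y - x) / \<beta>\<close>, which is the optimal shift in the smoothness bound for \<open>f\<close>.
\<close>

lemma conjugate_lower_grad_inv:
  assumes x: "x \<in> carrier_vec d" and y: "y \<in> carrier_vec d"
  shows "fenchel_conjugate d f y \<ge> fenchel_conjugate d f x + grad_inv x \<bullet> (y - x)
           + ((y - x) \<bullet> (y - x)) / (2 * \<beta>)"
proof -
  define a where "a = grad_inv x"
  define v where "v = y - x"
  define b where "b = a + (1 / \<beta>) \<cdot>\<^sub>v v"
  have a: "a \<in> carrier_vec d" "gradient d f a = x" and v: "v \<in> carrier_vec d"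
    using grad_inv x y by (auto simp: a_def v_def)
  have b: "b \<in> carrier_vec d" "b - a = (1 / \<beta>) \<cdot>\<^sub>v v" using a v by (auto simp: b_def)
  have "f b \<le> f a + (x \<bullet> v) / \<beta> + \<beta> / 2 * ((1 / \<beta>) * ((1 / \<beta>) * (v \<bullet> v)))"
    using upper_bound[OF a(1) b(1)] a b x v by simp
  also have "\<beta> / 2 * ((1 / \<beta>) * ((1 / \<beta>) * (v \<bullet> v))) = (v \<bullet> v) / (2 * \<beta>)"
    using \<beta>_pos by (simp add: field_simps)
  finally have u: "f b \<le> f a + (x \<bullet> v) / \<beta> + (v \<bullet> v) / (2 * \<beta>)" .
  have "y \<bullet> b = x \<bullet> a + v \<bullet> a + (x \<bullet> v) / \<beta> + (v \<bullet> v) / \<beta>"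
  proof -
    have "y = x + v" using x y by (auto simp: v_def)
    then show ?thesis using x a v
      by (simp add: b_def scalar_prod_add_distrib[of _ d] add_scalar_prod_distrib[of _ d] add_divide_distrib)
  qed
  moreover have "(v \<bullet> v) / \<beta> = (v \<bullet> v) / (2 * \<beta>) + (v \<bullet> v) / (2 * \<beta>)" using \<beta>_pos by (simp add: field_simps)
  ultimately have "x \<bullet> a - f a + a \<bullet> v + (v \<bullet> v) / (2 * \<beta>) \<le> y \<bullet> b - f b"
    using u comm_scalar_prod[OF a(1) v] by linarith
  also have "\<dots> \<le> fenchel_conjugate d f y"
    using fenchel_young[OF y b(1)] fenchel_conjugate_eq[OF y] by simp
  finally show ?thesis using fenchel_conjugate_eq[OF x] by (simp add: a_def v_def)
qed

text \<open>
  The two quadratic bounds around \<open>x\<close> squeeze the conjugate so that it is differentiable there.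
\<close>

lemma gradient_conjugate_eq:
  assumes x: "x \<in> carrier_vec d"
  shows "gradient d (fenchel_conjugate d f) x = grad_inv x"
proof (rule gradient_eqI[OF x])
  show "has_gradient d (fenchel_conjugate d f) (grad_inv x) x"
    unfolding has_gradient_def
  proof (intro conjI allI impI)
    fix e :: real assume e: "e > 0"
    show "\<exists>r>0. \<forall>y\<in>carrier_vec d. vnorm (y - x) < r \<longrightarrow>
      \<bar>fenchel_conjugate d f y - fenchel_conjugate d f x - grad_inv x \<bullet> (y - x)\<bar> \<le> e * vnorm (y - x)"
    proof (intro exI[of _ "2 * \<alpha> * e"] conjI ballI impI)
      fix y assume y: "y \<in> carrier_vec d" and n: "vnorm (y - x) < 2 * \<alpha> * e"
      have "((y - x) \<bullet> (y - x)) / (2 * \<alpha>) = vnorm (y - x) * (vnorm (y - x) / (2 * \<alpha>))"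
        by (simp add: vnorm_sq[symmetric] power2_eq_square)
      also have "\<dots> \<le> vnorm (y - x) * e"
        using n \<alpha>_pos by (intro mult_left_mono) (auto simp: field_simps)
      finally have "((y - x) \<bullet> (y - x)) / (2 * \<alpha>) \<le> e * vnorm (y - x)" by (simp add: mult.commute)
      moreover have "((y - x) \<bullet> (y - x)) / (2 * \<beta>) \<ge> 0" using \<beta>_pos sprod_self_ge_0 by simp
      ultimately show "\<bar>fenchel_conjugate d f y - fenchel_conjugate d f x - grad_inv x \<bullet> (y - x)\<bar>
          \<le> e * vnorm (y - x)"
        using conjugate_upper_grad_inv[OF x y] conjugate_lower_grad_inv[OF x y] by linarith
    qed (use e \<alpha>_pos in auto)
  qed (use grad_inv[OF x] in auto)
qed

lemma gradient_conjugate: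
  assumes "x \<in> carrier_vec d"
  shows "gradient d (fenchel_conjugate d f) x \<in> carrier_vec d"
    "gradient d f (gradient d (fenchel_conjugate d f) x) = x"
  using grad_inv[OF assms] gradient_conjugate_eq[OF assms] by auto

lemma grad_inj:
  assumes a: "a \<in> carrier_vec d" and b: "b \<in> carrier_vec d" and eq: "gradient d f a = gradient d f b"
  shows "a = b"
proof -
  have "\<alpha> * ((a - b) \<bullet> (a - b)) \<le> 0"
    using grad_strongly_monotone[OF a b] eq grad_carrier[OF b] a b by simp
  then have "(a - b) \<bullet> (a - b) = 0"
    using \<alpha>_pos sprod_self_ge_0[of "a - b"] by (simp add: mult_le_0_iff)
  then have "a - b = 0\<^sub>v d" by (intro sprod_self_eq_0) (use a b in simp_all)
  then show ?thesis using a b vec_minus_add_cancel[OF b a] by simp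
qed

lemma gradient_conjugate_gradient:
  assumes "\<theta> \<in> carrier_vec d"
  shows "gradient d (fenchel_conjugate d f) (gradient d f \<theta>) = \<theta>"
  using grad_inj[OF gradient_conjugate(1) assms gradient_conjugate(2)] grad_carrier[OF assms] by simp

lemma conjugate_bounds:
  assumes x: "x \<in> carrier_vec d" and y: "y \<in> carrier_vec d"
  shows "fenchel_conjugate d f y \<le> fenchel_conjugate d f x
           + gradient d (fenchel_conjugate d f) x \<bullet> (y - x) + ((y - x) \<bullet> (y - x)) / (2 * \<alpha>)"
    and "fenchel_conjugate d f y \<ge> fenchel_conjugate d f x
           + gradient d (fenchel_conjugate d f) x \<bullet> (y - x) + ((y - x) \<bullet> (y - x)) / (2 * \<beta>)"
  using conjugate_upper_grad_inv[OF x y] conjugate_lower_grad_inv[OF x y]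
  unfolding gradient_conjugate_eq[OF x] by auto

text \<open>
  This carries a rate for the dual iterates over to the primal ones.
\<close>

lemma gradient_conjugate_Lipschitz:
  assumes x: "x \<in> carrier_vec d" and y: "y \<in> carrier_vec d"
  defines "a \<equiv> gradient d (fenchel_conjugate d f) x" and "b \<equiv> gradient d (fenchel_conjugate d f) y"
  shows "(a - b) \<bullet> (a - b) \<le> ((x - y) \<bullet> (x - y)) / \<alpha>\<^sup>2"
proof -
  have c: "a \<in> carrier_vec d" "b \<in> carrier_vec d" "gradient d f a = x" "gradient d f b = y"
    using gradient_conjugate x y by (auto simp: a_def b_def)
  have "\<alpha> * ((a - b) \<bullet> (a - b)) \<le> (x - y) \<bullet> (a - b)"
    using grad_strongly_monotone[OF c(1,2)] c by simp
  also have "\<dots> \<le> \<alpha> / 2 * ((a - b) \<bullet> (a - b)) + ((x - y) \<bullet> (x - y)) / (2 * \<alpha>)"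
    by (rule sprod_le_Young[of _ d]) (use c x y \<alpha>_pos in auto)
  finally show ?thesis using \<alpha>_pos by (simp add: field_simps power2_eq_square)
qed

end

section \<open>Orthogonal diagonalization of real symmetric matrices\<close>

text \<open>
  Over the complex numbers the characteristic polynomial splits. For an eigenvector \<open>v\<close>, symmetry
  makes \<open>v\<^sup>* A v = a \<parallel>v\<parallel>\<^sup>2\<close> equal to its own conjugate, so every root \<open>a\<close> is real.
\<close>

lemma real_symmetric_char_poly_splits:
  fixes A :: "real mat"
  assumes A: "A \<in> carrier_mat n n" and sym: "transpose_mat A = A"
  shows "\<exists>es. char_poly A = (\<Prod>e\<leftarrow>es. [:- e, 1:])"
proof -
  define B where "B = map_mat complex_of_real A"
  have B: "B \<in> carrier_mat n n" using A by (simp add: B_def)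
  obtain as where as: "char_poly B = (\<Prod>a\<leftarrow>as. [:- a, 1:])"
    using char_poly_factorized[OF B] by blast
  have entry: "A $$ (i, j) = A $$ (j, i)" if "i < n" "j < n" for i j
    using sym A that by (metis carrier_matD index_transpose_mat(1))
  have real: "Im a = 0" if a: "a \<in> set as" for a
  proof -
    have "poly (char_poly B) a = 0"
      using a unfolding as by (induction as) auto
    then obtain v where v: "v \<in> carrier_vec n" "v \<noteq> 0\<^sub>v n" "B *\<^sub>v v = a \<cdot>\<^sub>v v"
      using eigenvalue_root_char_poly[OF B] B unfolding eigenvalue_def eigenvector_def by auto
    have row: "(\<Sum>j<n. of_real (A $$ (i, j)) * v $ j) = a * v $ i" if i: "i < n" for i
    proof -
      have "(B *\<^sub>v v) $ i = (\<Sum>j<n. of_real (A $$ (i, j)) * v $ j)"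
        using i A v(1) by (simp add: B_def scalar_prod_def lessThan_atLeast0)
      then show ?thesis using v i by simp
    qed
    \<comment> \<open>\<open>S\<close> is the Hermitian form \<open>v\<^sup>* A v\<close>, and \<open>N\<close> is \<open>\<parallel>v\<parallel>\<^sup>2\<close>.\<close>
    define S where "S = (\<Sum>i<n. cnj (v $ i) * (\<Sum>j<n. of_real (A $$ (i, j)) * v $ j))"
    define N where "N = (\<Sum>i<n. (cmod (v $ i))\<^sup>2)"
    have "S = (\<Sum>i<n. \<Sum>j<n. cnj (v $ i) * of_real (A $$ (i, j)) * v $ j)"
      by (simp add: S_def sum_distrib_left mult.assoc)
    also have "\<dots> = (\<Sum>j<n. \<Sum>i<n. cnj (v $ i) * of_real (A $$ (i, j)) * v $ j)"
      by (rule sum.swap)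
    also have "\<dots> = (\<Sum>j<n. \<Sum>i<n. cnj (v $ i) * of_real (A $$ (j, i)) * v $ j)"
      by (intro sum.cong refl) (simp add: entry)
    also have "\<dots> = cnj S"
      by (simp add: S_def sum_distrib_left mult_ac)
    finally have "Im S = 0" by (metis Reals_cnj_iff complex_is_Real_iff)
    moreover have "S = a * of_real N"
    proof -
      have "S = (\<Sum>i<n. a * (v $ i * cnj (v $ i)))"
        unfolding S_def by (intro sum.cong refl) (simp add: row)
      also have "\<dots> = a * of_real N"
        by (simp add: N_def sum_distrib_left complex_norm_square[symmetric])
      finally show ?thesis .
    qed
    ultimately have "Im a * N = 0" by simp
    moreover have "N \<noteq> 0"
    proof
      assume "N = 0"
      then have "\<forall>i\<in>{..<n}. (cmod (v $ i))\<^sup>2 = 0"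
        unfolding N_def by (subst (asm) sum_nonneg_eq_0_iff) auto
      then have "v = 0\<^sub>v n" using v(1) by (intro eq_vecI) auto
      with v(2) show False by simp
    qed
    ultimately show ?thesis by simp
  qed
  have as_real: "map (\<lambda>a. of_real (Re a)) as = as"
    by (intro map_idI) (simp add: complex_eq_iff real)
  interpret h: map_poly_inj_idom_hom "of_real :: real \<Rightarrow> complex" ..
  have "map_poly of_real (char_poly A) = char_poly B"
    unfolding B_def by (rule of_real_hom.char_poly_hom[OF A, symmetric])
  also have "\<dots> = (\<Prod>a\<leftarrow>map (\<lambda>a. of_real (Re a)) as. [:- a, 1:])"
    unfolding as_real by (rule as)
  also have "\<dots> = map_poly of_real (\<Prod>e\<leftarrow>map Re as. [:- e, 1:])"
    by (simp add: h.hom_prod_list comp_def)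
  finally have "char_poly A = (\<Prod>e\<leftarrow>map Re as. [:- e, 1:])" by (rule h.injectivity)
  then show ?thesis by blast
qed

text \<open>
  Complete \<open>v\<close> to a basis and apply Gram-Schmidt, which keeps the first vector but only
  orthogonalizes; the columns are therefore normalized afterwards.
\<close>

lemma orthonormal_completion:
  fixes v :: "real vec"
  assumes v: "v \<in> carrier_vec n" and unit: "v \<bullet> v = 1"
  obtains W where "W \<in> carrier_mat n n" "transpose_mat W * W = 1\<^sub>m n" "col W 0 = v"
proof -
  have v0: "v \<noteq> 0\<^sub>v n" using unit v by auto
  have n: "n \<noteq> 0"
  proof
    assume "n = 0" with unit v show False by (simp add: scalar_prod_def)
  qed
  interpret cof_vec_space n "TYPE(real)" .
  define b where "b = basis_completion v"
  define ws where "ws = gram_schmidt n b"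
  from basis_completion[OF v v0, folded b_def]
  have b: "distinct b" "\<not> lin_dep (set b)" "set b \<subseteq> carrier_vec n" "hd b = v" "length b = n"
    by auto
  from b n obtain vs where bv: "b = v # vs" by (cases b) auto
  from gram_schmidt_result[OF b(3,1,2) refl, folded ws_def]
  have ws: "set ws \<subseteq> carrier_vec n" "corthogonal ws" "length ws = n"
    by (auto simp: b)
  have hd: "ws ! 0 = v"
    using gram_schmidt_hd[OF v, of vs, folded bv ws_def] ws n hd_conv_nth[of ws] by auto
  define us where "us = map (\<lambda>w. (1 / vnorm w) \<cdot>\<^sub>v w) ws"
  define W where "W = mat_of_cols n us"
  have wsc: "ws ! i \<in> carrier_vec n" if "i < n" for i using ws that by auto
  have W: "W \<in> carrier_mat n n" using ws(3) mat_of_cols_carrier(1)[of n us] by (simp add: W_def us_def)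
  have colW: "col W i = (1 / vnorm (ws ! i)) \<cdot>\<^sub>v ws ! i" if "i < n" for i
    using that wsc[OF that] ws(3) by (simp add: W_def us_def)
  have "transpose_mat W * W = 1\<^sub>m n"
  proof (rule eq_matI)
    fix i j assume "i < dim_row (1\<^sub>m n :: real mat)" "j < dim_col (1\<^sub>m n :: real mat)"
    then have ij: "i < n" "j < n" by auto
    have orth: "ws ! i \<bullet> ws ! j = 0 \<longleftrightarrow> i \<noteq> j"
      using corthogonalD[OF ws(2), of i j] ij ws(3) by simp
    have "(transpose_mat W * W) $$ (i, j) = col W i \<bullet> col W j"
      using ij W by simp
    also have "\<dots> = (ws ! i \<bullet> ws ! j) / (vnorm (ws ! i) * vnorm (ws ! j))"
      using ij wsc[of i] wsc[of j] by (simp add: colW)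
    also have "\<dots> = (1\<^sub>m n) $$ (i, j)"
    proof (cases "i = j")
      case True
      then have "(vnorm (ws ! i))\<^sup>2 \<noteq> 0" using orth by (simp add: vnorm_sq)
      then show ?thesis using True ij by (simp add: vnorm_sq[symmetric] power2_eq_square)
    next
      case False
      then show ?thesis using orth ij by simp
    qed
    finally show "(transpose_mat W * W) $$ (i, j) = (1\<^sub>m n) $$ (i, j)" .
  qed (use W in auto)
  moreover have "col W 0 = v"
    using colW[of 0] n hd unit v by (simp add: vnorm_def)
  ultimately show thesis using that W by blast
qed

text \<open>
  Deflation: in an orthonormal basis that starts with an eigenvector, a symmetric matrix is block
  diagonal, with the eigenvalue in the corner and a smaller symmetric matrix as the other block.
  The list \<open>es\<close> fixes the order of the eigenvalues on the diagonal, so that they can later be taken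
  in decreasing order.
\<close>

lemma symmetric_orthogonal_diagonalization:
  fixes A :: "real mat"
  assumes "A \<in> carrier_mat n n" "transpose_mat A = A" "char_poly A = (\<Prod>e\<leftarrow>es. [:- e, 1:])"
  shows "\<exists>U\<in>carrier_mat n n. transpose_mat U * U = 1\<^sub>m n \<and>
           A * U = U * mat n n (\<lambda>(i, j). if i = j then es ! i else 0)"
  using assms
proof (induction es arbitrary: n A)
  case Nil
  have "n = 0" using degree_monic_char_poly[OF Nil(1)] Nil(3) by simp
  then show ?case using Nil(1) by (intro bexI[of _ "1\<^sub>m 0"]) auto
next
  case (Cons e es)
  note A = Cons.prems(1) and sym = Cons.prems(2)
  have cp: "char_poly A = [:- e, 1:] * (\<Prod>e\<leftarrow>es. [:- e, 1:])" using Cons.prems(3) by simp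
  then have "poly (char_poly A) e = 0" by simp
  then obtain w where w: "w \<in> carrier_vec n" "w \<noteq> 0\<^sub>v n" "A *\<^sub>v w = e \<cdot>\<^sub>v w"
    using eigenvalue_root_char_poly[OF A] A unfolding eigenvalue_def eigenvector_def by auto
  define v where "v = (1 / vnorm w) \<cdot>\<^sub>v w"
  have "w \<bullet> w \<noteq> 0" using w sprod_self_eq_0 by blast
  then have wn: "vnorm w \<noteq> 0" by (simp add: vnorm_sq[symmetric])
  have v: "v \<in> carrier_vec n" "A *\<^sub>v v = e \<cdot>\<^sub>v v"
    using w A by (auto simp: v_def mult_mat_vec smult_smult_assoc mult.commute)
  have "v \<bullet> v = 1"
    using wn unfolding vnorm_sq[symmetric] v_def vnorm_smult by (simp add: power2_eq_square)
  then obtain W where W: "W \<in> carrier_mat n n" "transpose_mat W * W = 1\<^sub>m n" "col W 0 = v"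
    using orthonormal_completion[OF v(1)] by blast
  have Wt: "transpose_mat W \<in> carrier_mat n n" using W by simp
  have WW: "W * transpose_mat W = 1\<^sub>m n"
    by (rule mat_mult_left_right_inverse[OF Wt W(1,2)])
  have n: "n \<noteq> 0"
  proof
    assume "n = 0" with \<open>v \<bullet> v = 1\<close> v show False by (simp add: scalar_prod_def)
  qed
  define k where "k = n - 1"
  have nk: "n = Suc k" using n by (simp add: k_def)
  define A' where "A' = transpose_mat W * A * W"
  have A': "A' \<in> carrier_mat n n" using W A by (simp add: A'_def)
  have A'sym: "transpose_mat A' = A'"
    using W(1) Wt A sym unfolding A'_def
    by (simp add: transpose_mult[of _ n n _ n])
  have A'0: "A' $$ (i, 0) = (if i = 0 then e else 0)" if i: "i < n" for i
  proof -
    have "A' $$ (i, 0) = (transpose_mat W * (A * W)) $$ (i, 0)"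
      using W(1) Wt A by (simp add: A'_def)
    also have "\<dots> = col W i \<bullet> col (A * W) 0"
      using i n W(1) A by (simp del: col_mult2)
    also have "col (A * W) 0 = A *\<^sub>v col W 0"
      using n by (intro col_mult2[OF A W(1)]) simp
    also have "col W i \<bullet> (A *\<^sub>v col W 0) = e * (col W i \<bullet> col W 0)"
      unfolding W(3) v(2) using v(1) W(1) i by simp
    also have "col W i \<bullet> col W 0 = (transpose_mat W * W) $$ (i, 0)"
      using i n W(1) by simp
    finally show ?thesis using W(2) i n by simp
  qed
  have A'0': "A' $$ (0, i) = (if i = 0 then e else 0)" if i: "i < n" for i
    using A'0[OF i] A'sym A' i n by (metis carrier_matD index_transpose_mat(1) neq0_conv)
  define E where "E = mat 1 1 (\<lambda>_. e)"
  define A3 where "A3 = mat k k (\<lambda>(i, j). A' $$ (Suc i, Suc j))"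
  have E: "E \<in> carrier_mat 1 1" and A3: "A3 \<in> carrier_mat k k" by (auto simp: E_def A3_def)
  have block: "A' = four_block_mat E (0\<^sub>m 1 k) (0\<^sub>m k 1) A3"
    by (rule eq_matI) (use A' A'0 A'0' in \<open>auto simp: E_def A3_def nk\<close>)
  have A3sym: "transpose_mat A3 = A3"
  proof (rule eq_matI)
    fix i j assume "i < dim_row A3" "j < dim_col A3"
    then have ij: "i < k" "j < k" by (auto simp: A3_def)
    have "A' $$ (Suc j, Suc i) = transpose_mat A' $$ (Suc i, Suc j)"
      using A' ij by (simp add: nk)
    then show "transpose_mat A3 $$ (i, j) = A3 $$ (i, j)"
      using ij by (simp add: A3_def A'sym)
  qed (use A3 in auto)
  have "similar_mat A' A"
    by (rule similar_matI[of _ _ "transpose_mat W" W n]) (use W(1,2) WW A A' in \<open>auto simp: A'_def\<close>)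
  then have "char_poly A' = [:- e, 1:] * (\<Prod>e\<leftarrow>es. [:- e, 1:])"
    using char_poly_similar cp by metis
  moreover have "char_poly A' = char_poly E * char_poly A3"
    unfolding block by (rule char_poly_four_block_zeros_col[OF E _ A3]) simp
  moreover have "char_poly E = [:- e, 1:]"
    by (simp add: E_def char_poly_defs det_def sign_def)
  ultimately have "[:- e, 1:] * char_poly A3 = [:- e, 1:] * (\<Prod>e\<leftarrow>es. [:- e, 1:])" by metis
  then have "char_poly A3 = (\<Prod>e\<leftarrow>es. [:- e, 1:])"
    by (metis mult_cancel_left pCons_eq_0_iff zero_neq_one)
  from Cons.IH[OF A3 A3sym this] obtain U3 where
    U3: "U3 \<in> carrier_mat k k" "transpose_mat U3 * U3 = 1\<^sub>m k"
    and AU3: "A3 * U3 = U3 * mat k k (\<lambda>(i, j). if i = j then es ! i else 0)" by blast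
  define D3 where "D3 = mat k k (\<lambda>(i, j). if i = j then es ! i else (0::real))"
  define D where "D = mat n n (\<lambda>(i, j). if i = j then (e # es) ! i else (0::real))"
  define F where "F = four_block_mat (1\<^sub>m 1) (0\<^sub>m 1 k) (0\<^sub>m k 1) U3"
  have D3: "D3 \<in> carrier_mat k k" and D: "D \<in> carrier_mat n n" by (auto simp: D3_def D_def)
  have F: "F \<in> carrier_mat n n"
    unfolding F_def nk by (rule four_block_carrier_mat[of _ 1 1 _ k k, simplified]) (use U3 in auto)
  have Dblock: "D = four_block_mat E (0\<^sub>m 1 k) (0\<^sub>m k 1) D3"
    by (rule eq_matI) (auto simp: D_def D3_def E_def nk)
  have "A' * F = four_block_mat E (0\<^sub>m 1 k) (0\<^sub>m k 1) (A3 * U3)"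
    unfolding block F_def using E A3 U3
    by (subst mult_four_block_mat[of _ 1 1 _ k _ k _ _ 1 _ k]) auto
  also have "\<dots> = F * D"
    unfolding F_def Dblock AU3 D3_def[symmetric] using E D3 U3
    by (subst mult_four_block_mat[of _ 1 1 _ k _ k _ _ 1 _ k]) auto
  finally have A'F: "A' * F = F * D" .
  have FF: "transpose_mat F * F = 1\<^sub>m n"
    unfolding F_def using U3
    by (subst transpose_four_block_mat[of _ 1 1 _ k _ k], simp_all)
      (subst mult_four_block_mat[of _ 1 1 _ k _ k _ _ 1 _ k], auto simp: nk)
  have Ft: "transpose_mat F \<in> carrier_mat n n" using F by simp
  show ?case
  proof (intro bexI[of _ "W * F"] conjI)
    show "W * F \<in> carrier_mat n n" using W F by simp
    have "transpose_mat (W * F) * (W * F) = transpose_mat F * (transpose_mat W * W) * F"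
      using W(1) Wt F Ft by (simp add: transpose_mult[OF W(1) F] assoc_mult_mat[of _ n n _ n _ n])
    also have "\<dots> = 1\<^sub>m n" using W(2) FF Ft F by simp
    finally show "transpose_mat (W * F) * (W * F) = 1\<^sub>m n" .
    have "A * (W * F) = (W * transpose_mat W) * A * (W * F)"
      using WW A by simp
    also have "\<dots> = W * (A' * F)"
      unfolding A'_def using W(1) Wt F A by (simp add: assoc_mult_mat[of _ n n _ n _ n])
    also have "\<dots> = W * F * D"
      unfolding A'F using W(1) F D by (simp add: assoc_mult_mat[of _ n n _ n _ n])
    finally show "A * (W * F) = W * F * mat n n (\<lambda>(i, j). if i = j then (e # es) ! i else 0)"
      by (simp add: D_def)
  qed
qed

section \<open>Spectrum of a gossip matrix\<close>

lemma eigenvalue_list_symmetric: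
  fixes A :: "real mat"
  assumes A: "A \<in> carrier_mat n n" "transpose_mat A = A"
  shows "char_poly A = (\<Prod>e\<leftarrow>eigenvalue_list A. [:- e, 1:])"
    and "length (eigenvalue_list A) = n"
    and "\<And>i j. i \<le> j \<Longrightarrow> j < n \<Longrightarrow> eigenvalue_list A ! j \<le> eigenvalue_list A ! i"
proof -
  obtain es where es: "char_poly A = (\<Prod>e\<leftarrow>es. [:- e, 1:])"
    using real_symmetric_char_poly_splits[OF A] by blast
  have "proots (\<Prod>e\<leftarrow>es. [:- e, 1:]) = mset es" for es :: "real list"
  proof (induction es)
    case (Cons e es)
    have "(\<Prod>e\<leftarrow>es. [:- e, 1:]) \<noteq> 0" by auto
    then show ?case using Cons by (simp add: proots_mult del: mult_pCons_left)
  qed simp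
  then have m: "mset (eigenvalue_list A) = mset es"
    unfolding eigenvalue_list_def es by simp
  have "(\<Prod>e\<leftarrow>xs. [:- e, 1:]) = (\<Prod>e\<in>#mset xs. [:- e, 1:])" for xs :: "real list"
    by (induction xs) (simp_all del: mult_pCons_left)
  then show cp: "char_poly A = (\<Prod>e\<leftarrow>eigenvalue_list A. [:- e, 1:])"
    unfolding es by (simp add: m)
  show len: "length (eigenvalue_list A) = n"
    using degree_monic_char_poly[OF A(1)] degree_linear_factors[of uminus "eigenvalue_list A"]
    unfolding cp by simp
  have "sorted (rev (eigenvalue_list A))" by (simp add: eigenvalue_list_def)
  then show "eigenvalue_list A ! j \<le> eigenvalue_list A ! i" if "i \<le> j" "j < n" for i j
    using that len sorted_rev_nth_mono by metis
qed

lemma mult_diag_mat_index: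
  assumes A: "(A :: real mat) \<in> carrier_mat d n" and ij: "i < d" "j < n"
  shows "(A * mat n n (\<lambda>(i, j). if i = j then h i else 0)) $$ (i, j) = h j * A $$ (i, j)"
proof -
  have "(A * mat n n (\<lambda>(i, j). if i = j then h i else 0)) $$ (i, j)
      = (\<Sum>l\<in>{0..<n}. A $$ (i, l) * (if l = j then h l else 0))"
    using A ij by (simp add: scalar_prod_def)
  also have "\<dots> = h j * A $$ (i, j)"
    using ij by (subst sum.remove[of _ j]) auto
  finally show ?thesis .
qed

text \<open>
  The eigenvalues are nonnegative by semidefiniteness. At most one of them vanishes, because two
  orthonormal eigenvectors cannot both be multiples of \<open>ones n\<close>; one of them does, because otherwise
  \<open>ones n\<close> would be orthogonal to every eigenvector. In decreasing order the zero therefore comes last,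
  and the eigenvalue at index \<open>n - 2\<close> is the smallest positive one.
\<close>

lemma gossip_matrix_spectrum:
  assumes W: "gossip_matrix n G W" and n: "n \<ge> 2"
  obtains U lam where "U \<in> carrier_mat n n" "transpose_mat U * U = 1\<^sub>m n"
    "W * U = U * mat n n (\<lambda>(i, j). if i = j then lam i else 0)"
    "nth_eigenvalue 1 W = lam 0" "nth_eigenvalue (n - 1) W = lam (n - 2)"
    "\<And>j. j < n - 1 \<Longrightarrow> lam (n - 2) \<le> lam j \<and> lam j \<le> lam 0"
    "lam (n - 1) = 0" "lam (n - 2) > 0" "\<exists>c. col U (n - 1) = c \<cdot>\<^sub>v ones n"
proof -
  have Wc: "W \<in> carrier_mat n n" and sym: "transpose_mat W = W"
    and psd: "\<And>v. v \<in> carrier_vec n \<Longrightarrow> v \<bullet> (W *\<^sub>v v) \<ge> 0"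
    and ker: "mat_kernel W = {c \<cdot>\<^sub>v ones n |c. True}"
    using W by (auto simp: gossip_matrix_def)
  define lam where "lam = (!) (eigenvalue_list W)"
  note ev = eigenvalue_list_symmetric[OF Wc sym, folded lam_def]
  define D where "D = mat n n (\<lambda>(i, j). if i = j then lam i else 0)"
  obtain U where U: "U \<in> carrier_mat n n" "transpose_mat U * U = 1\<^sub>m n" and WU: "W * U = U * D"
    using symmetric_orthogonal_diagonalization[OF Wc sym ev(1)] unfolding D_def lam_def by blast
  have Ut: "transpose_mat U \<in> carrier_mat n n" using U by simp
  have UU: "U * transpose_mat U = 1\<^sub>m n" by (rule mat_mult_left_right_inverse[OF Ut U])
  have orth: "col U i \<bullet> col U j = (if i = j then 1 else 0)" if "i < n" "j < n" for i j
  proof -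
    have "col U i \<bullet> col U j = (transpose_mat U * U) $$ (i, j)" using that U(1) by simp
    then show ?thesis using that U(2) by simp
  qed
  have colc: "col U j \<in> carrier_vec n" for j using U by auto
  have ev_eq: "W *\<^sub>v col U j = lam j \<cdot>\<^sub>v col U j" if j: "j < n" for j
  proof -
    have "W *\<^sub>v col U j = col (W * U) j" using col_mult2[OF Wc U(1) j] by simp
    also have "\<dots> = lam j \<cdot>\<^sub>v col U j"
    proof (rule eq_vecI)
      fix i assume i: "i < dim_vec (lam j \<cdot>\<^sub>v col U j)"
      then have i: "i < n" using U by simp
      have "col (W * U) j $ i = (W * U) $$ (i, j)" using i j Wc U(1) by simp
      also have "\<dots> = lam j * U $$ (i, j)"
        unfolding WU D_def by (rule mult_diag_mat_index[OF U(1) i j])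
      finally show "col (W * U) j $ i = (lam j \<cdot>\<^sub>v col U j) $ i" using i j U(1) by simp
    qed (use Wc U in auto)
    finally show ?thesis .
  qed
  have nonneg: "lam j \<ge> 0" if "j < n" for j
    using psd[OF colc[of j]] ev_eq[OF that] orth[OF that that] colc[of j] by simp
  have zero_col: "\<exists>c. col U j = c \<cdot>\<^sub>v ones n" if "j < n" "lam j = 0" for j
  proof -
    have "0 \<cdot>\<^sub>v col U j = 0\<^sub>v n" using U(1) by (intro eq_vecI) auto
    then have "W *\<^sub>v col U j = 0\<^sub>v n" using ev_eq[OF that(1)] that(2) by simp
    then have "col U j \<in> mat_kernel W" using colc Wc by (intro mat_kernelI[of _ n n]) auto
    then show ?thesis unfolding ker by auto
  qed
  have zero_unique: "i = j" if i: "i < n" "lam i = 0" and j: "j < n" "lam j = 0" for i j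
  proof (rule ccontr)
    assume "i \<noteq> j"
    obtain a b where ab: "col U i = a \<cdot>\<^sub>v ones n" "col U j = b \<cdot>\<^sub>v ones n"
      using zero_col[OF i] zero_col[OF j] by blast
    have o: "ones n \<in> carrier_vec n" by (simp add: ones_def)
    have "a * b * (ones n \<bullet> ones n) = 0" "a * a * (ones n \<bullet> ones n) = 1" "b * b * (ones n \<bullet> ones n) = 1"
      using orth[of i j] orth[of i i] orth[of j j] i j \<open>i \<noteq> j\<close> o unfolding ab by auto
    then show False by auto
  qed
  have zero_exists: "\<exists>j<n. lam j = 0"
  proof (rule ccontr)
    assume "\<not> ?thesis"
    then have nz: "\<And>j. j < n \<Longrightarrow> lam j \<noteq> 0" by blast
    have o: "ones n \<in> carrier_vec n" by (simp add: ones_def)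
    have "1 \<cdot>\<^sub>v ones n \<in> mat_kernel W" unfolding ker by blast
    then have W1: "W *\<^sub>v ones n = 0\<^sub>v n" using mat_kernelD[OF Wc] by auto
    have "col U j \<bullet> ones n = 0" if j: "j < n" for j
    proof -
      \<comment> \<open>Eigenvectors for a nonzero eigenvalue are orthogonal to the kernel.\<close>
    have "lam j * (col U j \<bullet> ones n) = (W *\<^sub>v col U j) \<bullet> ones n"
        using ev_eq[OF j] colc[of j] o by simp
      also have "\<dots> = col U j \<bullet> (W *\<^sub>v ones n)"
        using transpose_vec_mult_scalar[OF Wc o colc[of j]] sym by metis
      also have "\<dots> = 0" unfolding W1 using colc by simp
      finally show ?thesis using nz[OF j] by simp
    qed
    then have "transpose_mat U *\<^sub>v ones n = 0\<^sub>v n"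
      using U(1) by (intro eq_vecI) auto
    moreover have "U *\<^sub>v 0\<^sub>v n = 0\<^sub>v n" using U(1) by (intro eq_vecI) auto
    ultimately have "(U * transpose_mat U) *\<^sub>v ones n = 0\<^sub>v n"
      using assoc_mult_mat_vec[OF U(1) Ut o] by simp
    then have "ones n = 0\<^sub>v n" unfolding UU using o by simp
    then have "ones n $ 0 = 0\<^sub>v n $ 0" by simp
    then show False using n by (simp add: ones_def)
  qed
  have last: "lam (n - 1) = 0"
  proof -
    obtain j where j: "j < n" "lam j = 0" using zero_exists by blast
    have "lam (n - 1) \<le> lam j" by (rule ev(3)) (use j in auto)
    then show ?thesis using nonneg[of "n - 1"] j n by simp
  qed
  show thesis
  proof (rule that[OF U WU[unfolded D_def]])
    show "nth_eigenvalue 1 W = lam 0" "nth_eigenvalue (n - 1) W = lam (n - 2)"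
      by (auto simp: nth_eigenvalue_def lam_def numeral_2_eq_2)
    show "lam (n - 2) \<le> lam j \<and> lam j \<le> lam 0" if "j < n - 1" for j
      using that n by (intro conjI ev(3)) auto
    show "lam (n - 1) = 0" by (rule last)
    have "lam (n - 2) \<noteq> 0" using zero_unique[of "n - 2" "n - 1"] last n by auto
    then show "lam (n - 2) > 0" using nonneg[of "n - 2"] n by simp
    show "\<exists>c. col U (n - 1) = c \<cdot>\<^sub>v ones n" by (rule zero_col) (use last n in auto)
  qed
qed

section \<open>Chebyshev acceleration of gossip\<close>

text \<open>
  The recursion of \<open>gossip_a\<close> is that of the Chebyshev polynomials of the first kind.
\<close>

lemma gossip_a_cos: "gossip_a (cos t) k = cos (real k * t)"
proof (induction k rule: induct_nat_012)
  case (ge2 k)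
  define w where "w = real (Suc k) * t"
  have "real (Suc (Suc k)) * t = w + t" "real k * t = w - t"
    by (simp_all add: w_def algebra_simps)
  moreover have "cos (w + t) + cos (w - t) = 2 * cos t * cos w"
    by (simp add: cos_add cos_diff)
  ultimately show ?case using ge2 unfolding gossip_a.simps(3) by (simp add: w_def)
qed auto

lemma gossip_a_abs_le_1:
  assumes "\<bar>s\<bar> \<le> 1"
  shows "\<bar>gossip_a s k\<bar> \<le> 1"
  using gossip_a_cos[of "arccos s" k] assms by (simp add: cos_arccos_abs)

text \<open>
  The hyperbolic counterpart of the cosine formula, for the growth of the polynomial outside \<open>[-1, 1]\<close>.
\<close>

lemma gossip_a_Joukowski:
  assumes r: "r \<noteq> 0"
  shows "gossip_a ((r + 1 / r) / 2) k = (r ^ k + 1 / r ^ k) / 2"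
proof (induction k rule: induct_nat_012)
  case (ge2 k)
  have "gossip_a ((r + 1 / r) / 2) (Suc (Suc k))
      = (r + 1 / r) * ((r ^ Suc k + 1 / r ^ Suc k) / 2) - (r ^ k + 1 / r ^ k) / 2"
    unfolding gossip_a.simps(3) ge2 by simp
  also have "\<dots> = (r ^ Suc (Suc k) + 1 / r ^ Suc (Suc k)) / 2"
    using r by (simp add: field_simps)
  finally show ?case .
qed auto

text \<open>
  In coordinates with respect to a common eigenbasis \<open>U\<close>, the matrix recursion of \<open>gossip_z\<close>
  becomes the scalar recursion of \<open>gossip_a\<close> in each coordinate.
\<close>

lemma gossip_z_eigenbasis:
  assumes U: "U \<in> carrier_mat n n" and M: "M \<in> carrier_mat n n" and X: "X \<in> carrier_mat d n"
    and MU: "M * U = U * mat n n (\<lambda>(i, j). if i = j then m i else 0)"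
  shows "gossip_z c2 M X k \<in> carrier_mat d n \<and>
    (\<forall>i<d. \<forall>j<n. (gossip_z c2 M X k * U) $$ (i, j) = gossip_a (c2 * m j) k * (X * U) $$ (i, j))"
proof -
  have step: "(Z * M * U) $$ (i, j) = m j * (Z * U) $$ (i, j)"
    if Z: "Z \<in> carrier_mat d n" and ij: "i < d" "j < n" for Z i j
  proof -
    let ?D = "mat n n (\<lambda>(i, j). if i = j then m i else 0)"
    have "Z * M * U = Z * U * ?D"
      using Z M U by (simp add: assoc_mult_mat[of _ d n _ n _ n] MU)
    moreover have "Z * U \<in> carrier_mat d n" using Z U by simp
    ultimately show ?thesis using mult_diag_mat_index[of "Z * U" d n i j m] ij by simp
  qed
  show ?thesis
  proof (induction k rule: induct_nat_012)
    case 0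
    show ?case using X by simp
  next
    case 1
    have "(c2 \<cdot>\<^sub>m (X * M)) * U = c2 \<cdot>\<^sub>m (X * M * U)"
      using X M U by (intro mult_smult_assoc_mat[of _ d n _ n]) auto
    then show ?case using X M U step[OF X] by simp
  next
    case (ge2 k)
    let ?Y = "gossip_z c2 M X k" and ?Z = "gossip_z c2 M X (Suc k)"
    have Y: "?Y \<in> carrier_mat d n" and Z: "?Z \<in> carrier_mat d n" using ge2 by auto
    have ZM: "?Z * M \<in> carrier_mat d n" using Z M by simp
    have "gossip_z c2 M X (Suc (Suc k)) * U = (2 * c2) \<cdot>\<^sub>m (?Z * M) * U - ?Y * U"
      using ZM Y U by (simp add: minus_mult_distrib_mat[of _ d n _ _ n])
    also have "(2 * c2) \<cdot>\<^sub>m (?Z * M) * U = (2 * c2) \<cdot>\<^sub>m (?Z * M * U)"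
      using ZM U by (rule mult_smult_assoc_mat)
    finally have eq: "gossip_z c2 M X (Suc (Suc k)) * U = (2 * c2) \<cdot>\<^sub>m (?Z * M * U) - ?Y * U" .
    have "(gossip_z c2 M X (Suc (Suc k)) * U) $$ (i, j)
        = gossip_a (c2 * m j) (Suc (Suc k)) * (X * U) $$ (i, j)" if ij: "i < d" "j < n" for i j
    proof -
      have "(gossip_z c2 M X (Suc (Suc k)) * U) $$ (i, j)
          = 2 * c2 * (?Z * M * U) $$ (i, j) - (?Y * U) $$ (i, j)"
        unfolding eq using ij Y Z ZM M U by simp
      also have "\<dots> = 2 * c2 * (m j * (?Z * U) $$ (i, j)) - (?Y * U) $$ (i, j)"
        unfolding step[OF Z ij] ..
      also have "\<dots> = gossip_a (c2 * m j) (Suc (Suc k)) * (X * U) $$ (i, j)"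
        using ge2 ij by (simp add: algebra_simps)
      finally show ?thesis .
    qed
    moreover have "gossip_z c2 M X (Suc (Suc k)) \<in> carrier_mat d n"
      unfolding gossip_z.simps by (rule minus_carrier_mat[OF Y])
    ultimately show ?case by blast
  qed
qed

text \<open>
  The step from \<open>W\<close> to accelerated gossip is the step from \<open>\<lambda>\<close> to \<open>1 - T\<^sub>K(c2 (1 - c3 \<lambda>)) / T\<^sub>K(c2)\<close>, where
  \<open>T\<^sub>K\<close> is the Chebyshev polynomial. The constants are chosen so that the positive eigenvalues of \<open>W\<close> go
  to arguments in \<open>[-1, 1]\<close>, where \<open>\<bar>T\<^sub>K\<bar> \<le> 1\<close>, and the eigenvalue \<open>0\<close> goes to \<open>c2 > 1\<close>, where \<open>T\<^sub>K\<close> is large.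
  So the kernel is kept and the nonzero spectrum is squeezed around \<open>1\<close>, with half-width
  \<open>1 / T\<^sub>K(c2) = 2 c / (1 + c\<^sup>2)\<close>.
\<close>

lemma acc_gossip_spectrum:
  fixes K :: nat
  assumes W: "gossip_matrix n G W" and n: "n \<ge> 2" and \<gamma>1: "eigengap n W < 1"
  defines "c \<equiv> msda_c1 (eigengap n W) ^ K"
  obtains U p where "eigengap n W > 0" "U \<in> carrier_mat n n" "transpose_mat U * U = 1\<^sub>m n"
    "\<exists>c. col U (n - 1) = c \<cdot>\<^sub>v ones n" "p (n - 1) = 0"
    "\<And>j. j < n - 1 \<Longrightarrow> (1 - c)\<^sup>2 / (1 + c\<^sup>2) \<le> p j \<and> p j \<le> (1 + c)\<^sup>2 / (1 + c\<^sup>2)"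
    "\<And>d X. X \<in> carrier_mat d n \<Longrightarrow> acc_gossip n X W K \<in> carrier_mat d n"
    "\<And>d X i j. X \<in> carrier_mat d n \<Longrightarrow> i < d \<Longrightarrow> j < n \<Longrightarrow>
        (acc_gossip n X W K * U) $$ (i, j) = p j * (X * U) $$ (i, j)"
proof -
  obtain U lam where U: "U \<in> carrier_mat n n" "transpose_mat U * U = 1\<^sub>m n"
    and WU: "W * U = U * mat n n (\<lambda>(i, j). if i = j then lam i else 0)"
    and ev: "nth_eigenvalue 1 W = lam 0" "nth_eigenvalue (n - 1) W = lam (n - 2)"
    and lam: "\<And>j. j < n - 1 \<Longrightarrow> lam (n - 2) \<le> lam j \<and> lam j \<le> lam 0"
    and lam0: "lam (n - 1) = 0" and lampos: "lam (n - 2) > 0"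
    and last: "\<exists>c. col U (n - 1) = c \<cdot>\<^sub>v ones n"
    by (rule gossip_matrix_spectrum[OF W n]) (rule that)
  have Wc: "W \<in> carrier_mat n n" using W by (simp add: gossip_matrix_def)
  define \<gamma> where "\<gamma> = eigengap n W"
  have \<gamma>: "\<gamma> = lam (n - 2) / lam 0" by (simp only: \<gamma>_def eigengap_def ev)
  have l0: "lam 0 > 0" using lam[of 0] lampos n by auto
  have g0: "\<gamma> > 0" using \<gamma> l0 lampos by simp
  have g1: "\<gamma> < 1" using \<gamma>1 by (simp add: \<gamma>_def)
  define c2 where "c2 = (1 + \<gamma>) / (1 - \<gamma>)"
  define c3 where "c3 = 2 / ((1 + \<gamma>) * lam 0)"
  define M where "M = 1\<^sub>m n - c3 \<cdot>\<^sub>m W"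
  define p where "p j = 1 - gossip_a (c2 * (1 - c3 * lam j)) K / gossip_a c2 K" for j
  have M: "M \<in> carrier_mat n n"
    unfolding M_def by (intro minus_carrier_mat smult_carrier_mat Wc)
  have MU: "M * U = U * mat n n (\<lambda>(i, j). if i = j then 1 - c3 * lam i else 0)"
  proof (rule eq_matI)
    fix i j assume "i < dim_row (U * mat n n (\<lambda>(i, j). if i = j then 1 - c3 * lam i else 0))"
      "j < dim_col (U * mat n n (\<lambda>(i, j). if i = j then 1 - c3 * lam i else 0))"
    then have ij: "i < n" "j < n" using U by auto
    note diag = mult_diag_mat_index[OF U(1) ij]
    have "M * U = U - c3 \<cdot>\<^sub>m (W * U)"
      using U(1) Wc unfolding M_def
      by (simp add: minus_mult_distrib_mat[of _ n n _ _ n] mult_smult_assoc_mat[of _ n n _ n])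
    then have "(M * U) $$ (i, j) = U $$ (i, j) - c3 * (W * U) $$ (i, j)"
      using ij U(1) Wc by simp
    then show "(M * U) $$ (i, j) = (U * mat n n (\<lambda>(i, j). if i = j then 1 - c3 * lam i else 0)) $$ (i, j)"
      unfolding WU diag by (simp add: algebra_simps)
  qed (use M U in auto)
  have acc: "acc_gossip n X W K = X - (1 / gossip_a c2 K) \<cdot>\<^sub>m gossip_z c2 M X K" for X
    unfolding acc_gossip_def Let_def c2_def c3_def M_def \<gamma>_def ev ..
  have s: "sqrt \<gamma> > 0" "sqrt \<gamma> < 1" "(sqrt \<gamma>)\<^sup>2 = \<gamma>" using g0 g1 by auto
  have "0 < (1 - t) / (1 + t) \<and> (1 - t) / (1 + t) < 1" if "0 < t" "t < 1" for t :: real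
    using that by simp
  then have r: "0 < msda_c1 \<gamma>" "msda_c1 \<gamma> < 1" unfolding msda_c1_def using s by blast+
  have c: "0 < c" "c \<le> 1" using r unfolding c_def \<gamma>_def by (auto intro: power_le_one)
  have c2_eq: "c2 = (msda_c1 \<gamma> + 1 / msda_c1 \<gamma>) / 2"
  proof -
    define s where "s = sqrt \<gamma>"
    have "(1 + s\<^sup>2) / (1 - s\<^sup>2) = ((1 - s) / (1 + s) + 1 / ((1 - s) / (1 + s))) / 2"
    proof -
      have "1 - s\<^sup>2 = (1 - s) * (1 + s)" by (simp add: power2_eq_square algebra_simps)
      moreover have nz: "1 - s \<noteq> 0" "1 + s \<noteq> 0" using s unfolding s_def by linarith+
      moreover have "(1 - s) / (1 + s) + 1 / ((1 - s) / (1 + s)) = ((1 - s) * (1 - s) + (1 + s) * (1 + s)) / ((1 + s) * (1 - s))"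
        using nz by (simp add: add_frac_eq)
      moreover have "(1 - s) * (1 - s) + (1 + s) * (1 + s) = 2 * (1 + s\<^sup>2)"
        by (simp add: power2_eq_square algebra_simps)
      moreover have "(2 * t) / ((1 + s) * (1 - s)) / 2 = t / ((1 - s) * (1 + s))" for t
        by (simp add: mult.commute)
      ultimately show ?thesis by (simp only:)
    qed
    then show ?thesis using s by (simp add: c2_def msda_c1_def s_def)
  qed
  have aK: "gossip_a c2 K = (1 + c\<^sup>2) / (2 * c)"
    unfolding c2_eq using gossip_a_Joukowski[of "msda_c1 \<gamma>" K] r c
    by (simp add: c_def \<gamma>_def[symmetric] field_simps power2_eq_square)
  have aKpos: "gossip_a c2 K > 0"
    unfolding aK using c by (intro divide_pos_pos add_pos_nonneg) auto
  have p0: "p (n - 1) = 0" unfolding p_def lam0 using aKpos by simp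
  have pj: "(1 - c)\<^sup>2 / (1 + c\<^sup>2) \<le> p j \<and> p j \<le> (1 + c)\<^sup>2 / (1 + c\<^sup>2)" if j: "j < n - 1" for j
  proof -
    define s where "s = c2 * (1 - c3 * lam j)"
    define q where "q = lam j / lam 0"
    have q: "\<gamma> \<le> q" "q \<le> 1" using lam[OF j] l0 by (auto simp: q_def \<gamma> divide_right_mono)
    have s: "s * (1 - \<gamma>) = 1 + \<gamma> - 2 * q"
    proof -
      have "c2 * (1 - \<gamma>) = 1 + \<gamma>" using g1 by (simp add: c2_def)
      moreover have "(1 + \<gamma>) * (c3 * lam j) = 2 * q"
      proof -
        have "c3 * lam j = 2 / (1 + \<gamma>) * q" by (simp add: c3_def q_def)
        then show ?thesis using g0 by simp
      qed
      moreover have "s * (1 - \<gamma>) = c2 * (1 - \<gamma>) - c2 * (1 - \<gamma>) * (c3 * lam j)"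
        by (simp add: s_def algebra_simps)
      ultimately show ?thesis by simp
    qed
    have "\<bar>s\<bar> \<le> 1"
    proof -
      have "s * (1 - \<gamma>) \<le> 1 * (1 - \<gamma>)" "(- 1) * (1 - \<gamma>) \<le> s * (1 - \<gamma>)"
        unfolding s using q by auto
      then have "s \<le> 1" "- 1 \<le> s" using g1 by (simp_all only: mult_le_cancel_right_pos diff_gt_0_iff_gt)
      then show ?thesis by simp
    qed
    then have b: "\<bar>gossip_a s K\<bar> \<le> 1" by (rule gossip_a_abs_le_1)
    have "\<bar>gossip_a s K / gossip_a c2 K\<bar> \<le> 1 / gossip_a c2 K"
      using b aKpos by (simp add: divide_right_mono)
    also have "1 / gossip_a c2 K = 2 * c / (1 + c\<^sup>2)" by (simp add: aK)
    finally have "\<bar>1 - p j\<bar> \<le> 2 * c / (1 + c\<^sup>2)" by (simp add: p_def s_def)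
    moreover have nz: "1 + c\<^sup>2 \<noteq> 0" using zero_le_power2[of c] by linarith
    moreover have "1 - 2 * c / (1 + c\<^sup>2) = (1 - c)\<^sup>2 / (1 + c\<^sup>2)" "1 + 2 * c / (1 + c\<^sup>2) = (1 + c)\<^sup>2 / (1 + c\<^sup>2)"
      using nz by (simp_all add: field_simps power2_eq_square)
    ultimately show ?thesis by linarith
  qed
  have car: "acc_gossip n X W K \<in> carrier_mat d n" if X: "X \<in> carrier_mat d n" for d X
    unfolding acc by (intro minus_carrier_mat smult_carrier_mat)
      (use gossip_z_eigenbasis[OF U(1) M X MU] in blast)
  have hat: "(acc_gossip n X W K * U) $$ (i, j) = p j * (X * U) $$ (i, j)"
    if X: "X \<in> carrier_mat d n" and ij: "i < d" "j < n" for d X i j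
  proof -
    let ?Z = "gossip_z c2 M X K"
    note z = gossip_z_eigenbasis[OF U(1) M X MU, of c2 K]
    then have Z: "?Z \<in> carrier_mat d n" by blast
    have "acc_gossip n X W K * U = X * U - (1 / gossip_a c2 K) \<cdot>\<^sub>m (?Z * U)"
      unfolding acc using X Z U(1)
      by (simp add: minus_mult_distrib_mat[of _ d n _ _ n] mult_smult_assoc_mat[of _ d n _ n])
    then have "(acc_gossip n X W K * U) $$ (i, j)
        = (X * U) $$ (i, j) - (1 / gossip_a c2 K) * (?Z * U) $$ (i, j)"
      using ij X Z U(1) by simp
    also have "(?Z * U) $$ (i, j) = gossip_a (c2 * (1 - c3 * lam j)) K * (X * U) $$ (i, j)"
      using z ij by blast
    finally show ?thesis by (simp add: p_def algebra_simps)
  qed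
  show thesis
    by (rule that[OF g0[unfolded \<gamma>_def] U last p0 pj car hat])
qed

section \<open>Constant-momentum accelerated gradient descent\<close>

text \<open>
  The part of the energy estimate that concerns one coordinate of the auxiliary sequence \<open>z\<close>: expand
  the square and use convexity of \<open>w \<mapsto> w\<^sup>2\<close> on the average of \<open>z - s\<close> and \<open>x - s\<close>.
\<close>

lemma accelerated_gradient_coordinate:
  fixes x z g s p q L :: real
  assumes p: "p > 0" and q: "0 < q" "q \<le> 1" and L: "L > 0"
  shows "L * q\<^sup>2 / 2 * (((1 - q) * z + q * x - p * g / (q * L) - s)\<^sup>2 / p)
    \<le> L * q\<^sup>2 / 2 * ((1 - q) * ((z - s)\<^sup>2 / p) + q * ((x - s)\<^sup>2 / p))
      - q * (g * ((1 - q) * (z - s) + q * (x - s))) + p * g\<^sup>2 / (2 * L)"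
proof -
  define a b w where "a = z - s" and "b = x - s" and "w = (1 - q) * a + q * b"
  have "(1 - q) * z + q * x - p * g / (q * L) - s = w - p * g / (q * L)"
    by (simp add: w_def a_def b_def algebra_simps)
  moreover have "L * q\<^sup>2 / 2 * ((w - p * g / (q * L))\<^sup>2 / p)
      = L * q\<^sup>2 / 2 * (w\<^sup>2 / p) - q * (g * w) + p * g\<^sup>2 / (2 * L)"
    using p q L by (simp add: power2_eq_square field_simps)
  moreover have "w\<^sup>2 \<le> (1 - q) * a\<^sup>2 + q * b\<^sup>2"
  proof -
    have "(1 - q) * a\<^sup>2 + q * b\<^sup>2 - w\<^sup>2 = q * (1 - q) * (a - b)\<^sup>2"
      by (simp add: w_def power2_eq_square algebra_simps)
    moreover have "\<dots> \<ge> 0" using q by simp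
    ultimately show ?thesis by linarith
  qed
  then have "w\<^sup>2 / p \<le> ((1 - q) * a\<^sup>2 + q * b\<^sup>2) / p"
    using p by (intro divide_right_mono) auto
  then have "L * q\<^sup>2 / 2 * (w\<^sup>2 / p) \<le> L * q\<^sup>2 / 2 * (((1 - q) * a\<^sup>2 + q * b\<^sup>2) / p)"
    using L by (intro mult_left_mono) auto
  moreover have "((1 - q) * a\<^sup>2 + q * b\<^sup>2) / p = (1 - q) * (a\<^sup>2 / p) + q * (b\<^sup>2 / p)"
    by (simp add: add_divide_distrib)
  ultimately have "L * q\<^sup>2 / 2 * (((1 - q) * z + q * x - p * g / (q * L) - s)\<^sup>2 / p)
      \<le> L * q\<^sup>2 / 2 * ((1 - q) * (a\<^sup>2 / p) + q * (b\<^sup>2 / p)) - q * (g * w) + p * g\<^sup>2 / (2 * L)"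
    by (simp only:)
  then show ?thesis unfolding a_def b_def w_def .
qed

text \<open>
  One step of Nesterov's method contracts the energy \<open>h(y) - h(s) + m/2 \<parallel>z - s\<parallel>\<^sup>2\<close> by \<open>1 - q\<close>, for a
  function \<open>h\<close> that is \<open>L\<close>-smooth and \<open>m\<close>-strongly convex, \<open>m = L q\<^sup>2\<close>, with minimizer \<open>s\<close>. Vectors are given by
  coordinates on a finite index set and the norm is \<open>\<Sum>i. v\<^sub>i\<^sup>2 / p\<^sub>i\<close>, so that \<open>p\<^sub>i g\<^sub>i\<close> is the gradient in this
  metric when \<open>g\<^sub>i\<close> is the Euclidean one. Only the values of \<open>h\<close> at the points involved enter.
\<close>

lemma accelerated_gradient_step:
  fixes x y y' x' z z' g s p :: "'i \<Rightarrow> real" and q L hx hy hy' hs :: real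
  assumes p: "\<And>i. i \<in> I \<Longrightarrow> p i > 0" and q: "0 < q" "q \<le> 1" and L: "L > 0"
    and y': "\<And>i. i \<in> I \<Longrightarrow> y' i = x i - p i * g i / L"
    and x': "\<And>i. i \<in> I \<Longrightarrow> x' i = (1 + (1 - q) / (1 + q)) * y' i - (1 - q) / (1 + q) * y i"
    and z: "\<And>i. i \<in> I \<Longrightarrow> z i = ((1 + q) * x i - y i) / q"
    and z': "\<And>i. i \<in> I \<Longrightarrow> z' i = ((1 + q) * x' i - y' i) / q"
    and descent: "hy' \<le> hx - (\<Sum>i\<in>I. p i * (g i)\<^sup>2) / (2 * L)"
    and lower_s: "hs \<ge> hx + (\<Sum>i\<in>I. g i * (s i - x i)) + L * q\<^sup>2 / 2 * (\<Sum>i\<in>I. (s i - x i)\<^sup>2 / p i)"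
    and lower_y: "hy \<ge> hx + (\<Sum>i\<in>I. g i * (y i - x i))"
  shows "hy' - hs + L * q\<^sup>2 / 2 * (\<Sum>i\<in>I. (z' i - s i)\<^sup>2 / p i)
    \<le> (1 - q) * (hy - hs + L * q\<^sup>2 / 2 * (\<Sum>i\<in>I. (z i - s i)\<^sup>2 / p i))"
proof -
  define m where "m = L * q\<^sup>2 / 2"
  define Z X P where "Z = (\<Sum>i\<in>I. (z i - s i)\<^sup>2 / p i)" and "X = (\<Sum>i\<in>I. (s i - x i)\<^sup>2 / p i)"
    and "P = (\<Sum>i\<in>I. p i * (g i)\<^sup>2)"
  define A B where "A = (\<Sum>i\<in>I. g i * (z i - s i))" and "B = (\<Sum>i\<in>I. g i * (x i - s i))"
  \<comment> \<open>The momentum is such that the gradient step acts on \<open>z\<close> as on a convex combination of \<open>z\<close> and \<open>x\<close>.\<close>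
  have z'_eq: "z' i = (1 - q) * z i + q * x i - p i * g i / (q * L)" if i: "i \<in> I" for i
  proof -
    have "(1 + q) * x' i = 2 * y' i - (1 - q) * y i"
    proof -
      define r where "r = (1 - q) / (1 + q)"
      have r: "(1 + q) * r = 1 - q" using q by (simp add: r_def)
      have "(1 + q) * x' i = (1 + q) * y' i + ((1 + q) * r) * y' i - ((1 + q) * r) * y i"
        unfolding x'[OF i] r_def[symmetric] by (simp add: algebra_simps)
      then show ?thesis unfolding r by (simp add: algebra_simps)
    qed
    moreover have "y i = (1 + q) * x i - q * z i"
      using q unfolding z[OF i] by simp
    ultimately have "z' i = (y' i - (1 - q) * ((1 + q) * x i - q * z i)) / q"
      by (simp add: z'[OF i])
    then show ?thesis using q L unfolding y'[OF i] by (simp add: field_simps)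
  qed
  have "m * (\<Sum>i\<in>I. (z' i - s i)\<^sup>2 / p i) = (\<Sum>i\<in>I. m * ((z' i - s i)\<^sup>2 / p i))"
    by (simp add: sum_distrib_left)
  also have "\<dots> \<le> (\<Sum>i\<in>I. m * ((1 - q) * ((z i - s i)\<^sup>2 / p i) + q * ((x i - s i)\<^sup>2 / p i))
      - q * (g i * ((1 - q) * (z i - s i) + q * (x i - s i))) + p i * (g i)\<^sup>2 / (2 * L))"
    by (intro sum_mono) (use accelerated_gradient_coordinate[OF p q L] z'_eq in \<open>simp add: m_def\<close>)
  also have "\<dots> = (\<Sum>i\<in>I. m * (1 - q) * ((z i - s i)\<^sup>2 / p i) + m * q * ((s i - x i)\<^sup>2 / p i)
      - q * (1 - q) * (g i * (z i - s i)) - q * q * (g i * (x i - s i)) + (1 / (2 * L)) * (p i * (g i)\<^sup>2))"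
    by (intro sum.cong refl) (simp add: algebra_simps power2_commute[of "x _"])
  also have "\<dots> = m * (1 - q) * Z + m * q * X - q * (1 - q) * A - q * q * B + (1 / (2 * L)) * P"
    unfolding Z_def X_def A_def B_def P_def by (simp only: sum.distrib sum_subtractf sum_distrib_left)
  finally have 1: "m * (\<Sum>i\<in>I. (z' i - s i)\<^sup>2 / p i)
      \<le> m * (1 - q) * Z + m * q * X - q * (1 - q) * A - q * q * B + P / (2 * L)" by simp
  have "(\<Sum>i\<in>I. g i * (s i - x i)) = - B"
    unfolding B_def sum_negf[symmetric] by (intro sum.cong refl) (simp add: algebra_simps)
  then have 2: "q * hx \<le> q * (hs + B - m * X)"
    using lower_s q unfolding m_def[symmetric] X_def[symmetric] by (intro mult_left_mono) auto
  have "(\<Sum>i\<in>I. g i * (y i - x i)) = (\<Sum>i\<in>I. q * (g i * (x i - s i)) - q * (g i * (z i - s i)))"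
  proof (intro sum.cong refl)
    fix i assume i: "i \<in> I"
    have "y i - x i = q * (x i - z i)"
    proof -
      have "q * z i = (1 + q) * x i - y i" using q unfolding z[OF i] by simp
      then show ?thesis by (simp add: algebra_simps)
    qed
    then show "g i * (y i - x i) = q * (g i * (x i - s i)) - q * (g i * (z i - s i))"
      by (simp only:) (simp add: algebra_simps)
  qed
  also have "\<dots> = q * B - q * A" by (simp add: A_def B_def sum_subtractf sum_distrib_left)
  finally have 3: "(1 - q) * hx \<le> (1 - q) * (hy - (q * B - q * A))"
    using lower_y q by (intro mult_left_mono) auto
  have 4: "hy' \<le> hx - P / (2 * L)" using descent by (simp add: P_def)
  \<comment> \<open>All terms in \<open>X\<close>, \<open>P\<close>, \<open>A\<close> and \<open>B\<close> cancel.\<close>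
  show ?thesis
    unfolding m_def[symmetric] Z_def[symmetric]
    using 1 2 3 4 by (simp add: algebra_simps)
qed

section \<open>The Frobenius inner product\<close>

definition frob :: "real mat \<Rightarrow> real mat \<Rightarrow> real" where
  "frob A B = (\<Sum>i<dim_row A. \<Sum>k<dim_col A. A $$ (i, k) * B $$ (i, k))"

lemma frob_eq_sum_cols:
  assumes "A \<in> carrier_mat d n" "B \<in> carrier_mat d n"
  shows "frob A B = (\<Sum>k<n. col A k \<bullet> col B k)"
proof -
  have "frob A B = (\<Sum>k<n. \<Sum>i<d. A $$ (i, k) * B $$ (i, k))"
    using assms unfolding frob_def by (subst sum.swap) simp
  also have "\<dots> = (\<Sum>k<n. col A k \<bullet> col B k)"
    using assms by (intro sum.cong refl) (simp add: scalar_prod_def lessThan_atLeast0)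
  finally show ?thesis .
qed

lemma frob_mult_orthogonal:
  assumes A: "A \<in> carrier_mat d n" and B: "B \<in> carrier_mat d n"
    and U: "U \<in> carrier_mat n n" and UU: "U * transpose_mat U = 1\<^sub>m n"
  shows "frob (A * U) (B * U) = frob A B"
proof -
  have Ut: "transpose_mat U \<in> carrier_mat n n" and Bt: "transpose_mat B \<in> carrier_mat n d"
    using U B by auto
  have "(A * U) * transpose_mat (B * U) = A * (U * transpose_mat U) * transpose_mat B"
    using A U Ut Bt by (simp add: transpose_mult[OF B U] assoc_mult_mat[of _ d n _ n _ d]
        assoc_mult_mat[of _ n n _ n _ d] assoc_mult_mat[of _ d n _ n _ n])
  then have eq: "(A * U) * transpose_mat (B * U) = A * transpose_mat B" using A UU by simp
  have "(\<Sum>k<n. (A * U) $$ (i, k) * (B * U) $$ (i, k)) = (\<Sum>k<n. A $$ (i, k) * B $$ (i, k))"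
    if i: "i < d" for i
  proof -
    have "(\<Sum>k<n. (A * U) $$ (i, k) * (B * U) $$ (i, k)) = ((A * U) * transpose_mat (B * U)) $$ (i, i)"
      using i A B U by (simp add: scalar_prod_def lessThan_atLeast0 del: index_mult_mat(1))
         (simp add: index_mult_mat(1)[of _ "A * U"] scalar_prod_def)
    also have "\<dots> = (\<Sum>k<n. A $$ (i, k) * B $$ (i, k))"
      unfolding eq using i A B by (simp add: scalar_prod_def lessThan_atLeast0)
    finally show ?thesis .
  qed
  then show ?thesis using A B U unfolding frob_def by simp
qed

section \<open>The dual iteration in the eigenbasis of the gossip polynomial\<close>

text \<open>
  The matrix \<open>U\<close> diagonalizes the accelerated gossip operator, with eigenvalues \<open>p\<close>; the last column
  spans the kernel. The dual iterates stay in the orthogonal complement of the kernel, where the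
  eigenvalues lie between \<open>(1 - c)\<^sup>2 / (1 + c\<^sup>2)\<close> and \<open>(1 + c)\<^sup>2 / (1 + c\<^sup>2)\<close>.
\<close>

locale msda =
  fixes n d :: nat and W U :: "real mat" and p :: "nat \<Rightarrow> real"
    and f :: "nat \<Rightarrow> real vec \<Rightarrow> real" and \<alpha> \<beta> c c0 :: real and \<theta>s :: "real vec"
  assumes n2: "n \<ge> 2" and f: "\<And>k. k < n \<Longrightarrow> smooth_strongly_convex d (f k) \<alpha> \<beta>"
    and c_def: "c = msda_c1 (eigengap n W) ^ msda_K (eigengap n W)" and c: "0 < c" "c < 1"
    and U: "U \<in> carrier_mat n n" and orth: "transpose_mat U * U = 1\<^sub>m n"
    and last_col: "col U (n - 1) = c0 \<cdot>\<^sub>v ones n"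
    and p_last: "p (n - 1) = 0"
    and p_bounds: "\<And>j. j < n - 1 \<Longrightarrow> (1 - c)\<^sup>2 / (1 + c\<^sup>2) \<le> p j \<and> p j \<le> (1 + c)\<^sup>2 / (1 + c\<^sup>2)"
    and acc_carrier: "\<And>X. X \<in> carrier_mat d n \<Longrightarrow>
          acc_gossip n X W (msda_K (eigengap n W)) \<in> carrier_mat d n"
    and acc_hat: "\<And>X i j. X \<in> carrier_mat d n \<Longrightarrow> i < d \<Longrightarrow> j < n \<Longrightarrow>
          (acc_gossip n X W (msda_K (eigengap n W)) * U) $$ (i, j) = p j * (X * U) $$ (i, j)"
    and minimizer: "is_arg_min (avg_fun n f) (\<lambda>\<theta>. \<theta> \<in> carrier_vec d) \<theta>s"
begin

abbreviation "\<Theta> \<equiv> dual_gradients d n f"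

definition x :: "nat \<Rightarrow> real mat" where "x t = fst (msda_state d n W f \<alpha> \<beta> t)"
definition y :: "nat \<Rightarrow> real mat" where "y t = snd (msda_state d n W f \<alpha> \<beta> t)"

text \<open>
  The dual objective, to be minimized over the matrices whose rows sum to zero.
\<close>

definition dual :: "real mat \<Rightarrow> real" where
  "dual X = (\<Sum>k<n. fenchel_conjugate d (f k) (col X k))"

text \<open>
  The dual is \<open>L\<close>-smooth and \<open>L q\<^sup>2\<close>-strongly convex in the norm weighted by \<open>1 / p\<close>; so \<open>q\<close> is the inverse
  square root of its condition number.
\<close>

definition L :: real where "L = (1 + c)\<^sup>2 / (1 + c\<^sup>2) / \<alpha>"
definition q :: real where "q = (1 - c) / ((1 + c) * sqrt (\<beta> / \<alpha>))"

text \<open>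
  The first-order condition of the dual asks for \<open>\<nabla>f\<^sub>k\<^sup>*\<close> at column \<open>k\<close> to be the same vector for all \<open>k\<close>;
  here it is \<open>\<theta>s\<close>, because \<open>\<nabla>f\<^sub>k\<^sup>*\<close> inverts \<open>\<nabla>f\<^sub>k\<close>.
\<close>

definition dual_opt :: "real mat" where
  "dual_opt = mat_of_cols d (map (\<lambda>k. gradient d (f k) \<theta>s) [0..<n])"

definition hat :: "real mat \<Rightarrow> nat \<times> nat \<Rightarrow> real" where "hat X ij = (X * U) $$ ij"

definition I :: "(nat \<times> nat) set" where "I = {..<d} \<times> {..<n - 1}"

text \<open>
  By \<open>hat_last\<close> below, this says that the rows of \<open>X\<close> sum to zero.
\<close>

definition centered :: "real mat \<Rightarrow> bool" where
  "centered X \<longleftrightarrow> (\<forall>i<d. hat X (i, n - 1) = 0)"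

lemma \<alpha>_pos: "0 < \<alpha>" and \<alpha>_le_\<beta>: "\<alpha> \<le> \<beta>"
  using f[of 0] n2 by (auto simp: smooth_strongly_convex_def)

lemma \<beta>_pos: "0 < \<beta>" using \<alpha>_pos \<alpha>_le_\<beta> by linarith

lemma L_pos: "0 < L"
  unfolding L_def using c \<alpha>_pos by (intro divide_pos_pos) (auto simp: add_pos_nonneg)

lemma q_pos: "0 < q"
  unfolding q_def using c \<alpha>_pos \<beta>_pos by (intro divide_pos_pos mult_pos_pos) auto

lemma q_le_1: "q \<le> 1"
proof -
  have "sqrt (\<beta> / \<alpha>) \<ge> 1" using \<alpha>_pos \<alpha>_le_\<beta> by simp
  then have "(1 + c) * 1 \<le> (1 + c) * sqrt (\<beta> / \<alpha>)" using c by (intro mult_left_mono) auto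
  then have "1 + c \<le> (1 + c) * sqrt (\<beta> / \<alpha>)" unfolding mult_1_right .
  then have "1 - c \<le> (1 + c) * sqrt (\<beta> / \<alpha>)" "0 < (1 + c) * sqrt (\<beta> / \<alpha>)" using c by linarith+
  then show ?thesis unfolding q_def by (subst pos_divide_le_eq) auto
qed

lemma L_q_sq: "L * q\<^sup>2 = (1 - c)\<^sup>2 / (1 + c\<^sup>2) / \<beta>"
proof -
  have "q\<^sup>2 = (1 - c)\<^sup>2 / (1 + c)\<^sup>2 * (\<alpha> / \<beta>)"
    using \<alpha>_pos \<beta>_pos by (simp add: q_def power_divide power_mult_distrib)
  moreover have "(1 + c)\<^sup>2 \<noteq> 0" using c by simp
  ultimately show ?thesis using \<alpha>_pos unfolding L_def by simp
qed

text \<open>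
  The step size and the momentum of the method are those of Nesterov's method for the constants
  \<open>L\<close> and \<open>q\<close>.
\<close>

lemma step_size: "msda_eta (eigengap n W) \<alpha> = 1 / L"
  by (simp add: msda_eta_def Let_def c_def[symmetric] L_def power_even_eq power_mult[symmetric] mult.commute[of 2])
    (simp add: c_def power_mult power2_eq_square power_mult_distrib mult.commute)

lemma momentum: "msda_mu (eigengap n W) (\<beta> / \<alpha>) = (1 - q) / (1 + q)"
proof -
  define a where "a = (1 + c) * sqrt (\<beta> / \<alpha>)"
  have a: "a > 0" unfolding a_def using c \<alpha>_pos \<beta>_pos by (intro mult_pos_pos) auto
  have "1 - q = (a - 1 + c) / a" "1 + q = (a + 1 - c) / a"
    unfolding q_def a_def[symmetric] using a by (simp_all add: field_simps)
  then have "(1 - q) / (1 + q) = (a - 1 + c) / (a + 1 - c)" using a by simp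
  then show ?thesis by (simp add: msda_mu_def Let_def c_def[symmetric] a_def)
qed

lemma \<Theta>_carrier: "\<Theta> X \<in> carrier_mat d n"
  by (simp add: dual_gradients_def mat_of_cols_carrier(1)[of d "map _ [0..<n]", simplified])

lemma col_\<Theta>:
  assumes X: "X \<in> carrier_mat d n" and k: "k < n"
  shows "col (\<Theta> X) k = gradient d (fenchel_conjugate d (f k)) (col X k)"
proof -
  interpret smooth_strongly_convex d "f k" \<alpha> \<beta> by (rule f[OF k])
  have "col X k \<in> carrier_vec d" using X by auto
  then show ?thesis using k gradient_conjugate(1) by (simp add: dual_gradients_def)
qed

lemma dual_bounds:
  assumes X: "X \<in> carrier_mat d n" and Y: "Y \<in> carrier_mat d n"
  shows "dual Y \<le> dual X + frob (\<Theta> X) (Y - X) + frob (Y - X) (Y - X) / (2 * \<alpha>)"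
    and "dual Y \<ge> dual X + frob (\<Theta> X) (Y - X) + frob (Y - X) (Y - X) / (2 * \<beta>)"
proof -
  have YX: "Y - X \<in> carrier_mat d n" using X Y by (intro minus_carrier_mat)
  have colc: "col X k \<in> carrier_vec d" "col Y k \<in> carrier_vec d" for k using X Y by auto
  have col: "col (Y - X) k = col Y k - col X k" if "k < n" for k
    using X Y that by (intro eq_vecI) auto
  have sum: "dual X + frob (\<Theta> X) (Y - X) + frob (Y - X) (Y - X) / (2 * r)
     = (\<Sum>k<n. fenchel_conjugate d (f k) (col X k)
         + gradient d (fenchel_conjugate d (f k)) (col X k) \<bullet> (col Y k - col X k)
         + ((col Y k - col X k) \<bullet> (col Y k - col X k)) / (2 * r))" for r
    unfolding dual_def frob_eq_sum_cols[OF \<Theta>_carrier YX] frob_eq_sum_cols[OF YX YX]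
    by (simp add: sum.distrib sum_divide_distrib col col_\<Theta>[OF X])
  show "dual Y \<le> dual X + frob (\<Theta> X) (Y - X) + frob (Y - X) (Y - X) / (2 * \<alpha>)"
    unfolding sum unfolding dual_def
    by (intro sum_mono smooth_strongly_convex.conjugate_bounds(1)[OF f] colc) auto
  show "dual Y \<ge> dual X + frob (\<Theta> X) (Y - X) + frob (Y - X) (Y - X) / (2 * \<beta>)"
    unfolding sum unfolding dual_def
    by (intro sum_mono smooth_strongly_convex.conjugate_bounds(2)[OF f] colc) auto
qed

lemma hat_minus:
  assumes "A \<in> carrier_mat d n" "B \<in> carrier_mat d n" "i < d" "j < n"
  shows "hat (A - B) (i, j) = hat A (i, j) - hat B (i, j)"
  using assms U by (simp add: hat_def minus_mult_distrib_mat[of _ d n _ _ n] del: index_mult_mat(1))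

lemma hat_smult:
  assumes "A \<in> carrier_mat d n" "i < d" "j < n"
  shows "hat (r \<cdot>\<^sub>m A) (i, j) = r * hat A (i, j)"
  using assms U by (simp add: hat_def mult_smult_assoc_mat[of _ d n _ n] del: index_mult_mat(1))

text \<open>
  Parseval's identity; the last column of the eigenbasis does not contribute for a centered matrix.
\<close>

lemma frob_hat:
  assumes A: "A \<in> carrier_mat d n" and B: "B \<in> carrier_mat d n" and "centered B"
  shows "frob A B = (\<Sum>ij\<in>I. hat A ij * hat B ij)"
proof -
  have UU: "U * transpose_mat U = 1\<^sub>m n"
    using mat_mult_left_right_inverse[OF _ U orth] U by simp
  have "frob A B = frob (A * U) (B * U)"
    using frob_mult_orthogonal[OF A B U UU] by simp
  also have "\<dots> = (\<Sum>i<d. \<Sum>j<n. hat A (i, j) * hat B (i, j))"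
    using A B U by (simp add: frob_def hat_def del: index_mult_mat(1))
  also have "\<dots> = (\<Sum>i<d. \<Sum>j<n - 1. hat A (i, j) * hat B (i, j))"
  proof (rule sum.cong[OF refl])
    fix i assume "i \<in> {..<d}"
    then have "hat B (i, n - 1) = 0" using assms(3) by (simp add: centered_def)
    moreover have "{..<n} = insert (n - 1) {..<n - 1}" using n2 by auto
    ultimately show "(\<Sum>j<n. hat A (i, j) * hat B (i, j)) = (\<Sum>j<n - 1. hat A (i, j) * hat B (i, j))"
      by simp
  qed
  also have "\<dots> = (\<Sum>ij\<in>I. hat A ij * hat B ij)"
    unfolding I_def by (subst sum.cartesian_product) (simp add: case_prod_beta')
  finally show ?thesis .
qed

lemma hat_last:
  assumes "A \<in> carrier_mat d n" "i < d"
  shows "hat A (i, n - 1) = c0 * (\<Sum>k<n. A $$ (i, k))"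
proof -
  have "hat A (i, n - 1) = row A i \<bullet> col U (n - 1)"
    using assms U n2 by (simp add: hat_def)
  then show ?thesis
    using assms U n2 unfolding last_col
    by (simp add: ones_def scalar_prod_def lessThan_atLeast0 sum_distrib_left mult.commute)
qed

lemma c0_nonzero: "c0 \<noteq> 0"
proof
  assume "c0 = 0"
  have "col U (n - 1) \<bullet> col U (n - 1) = (transpose_mat U * U) $$ (n - 1, n - 1)"
    using U n2 by simp
  also have "\<dots> = 1" using n2 by (simp add: orth)
  finally show False using \<open>c0 = 0\<close> unfolding last_col by (simp add: ones_def scalar_prod_def)
qed

lemma iterate_step:
  "x 0 = 0\<^sub>m d n" "y 0 = 0\<^sub>m d n"
  "y (Suc t) = x t - (1 / L) \<cdot>\<^sub>m acc_gossip n (\<Theta> (x t)) W (msda_K (eigengap n W))"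
  "x (Suc t) = (1 + (1 - q) / (1 + q)) \<cdot>\<^sub>m y (Suc t) - ((1 - q) / (1 + q)) \<cdot>\<^sub>m y t"
  by (simp_all add: x_def y_def Let_def case_prod_beta step_size momentum)

lemma iterate_carrier: "x t \<in> carrier_mat d n \<and> y t \<in> carrier_mat d n"
proof (induction t)
  case (Suc t)
  then have "y (Suc t) \<in> carrier_mat d n"
    unfolding iterate_step(3) by (intro minus_carrier_mat smult_carrier_mat acc_carrier \<Theta>_carrier)
  then show ?case using Suc unfolding iterate_step(4) by (auto intro!: minus_carrier_mat smult_carrier_mat)
qed (simp add: iterate_step)

lemmas x_carrier = iterate_carrier[THEN conjunct1] and y_carrier = iterate_carrier[THEN conjunct2]

lemma hat_y_Suc:
  assumes "i < d" "j < n"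
  shows "hat (y (Suc t)) (i, j) = hat (x t) (i, j) - p j * hat (\<Theta> (x t)) (i, j) / L"
proof -
  have "hat (acc_gossip n (\<Theta> (x t)) W (msda_K (eigengap n W))) (i, j) = p j * hat (\<Theta> (x t)) (i, j)"
    unfolding hat_def by (rule acc_hat[OF \<Theta>_carrier assms])
  then show ?thesis
    unfolding iterate_step(3)
    by (simp add: hat_minus hat_smult assms x_carrier acc_carrier \<Theta>_carrier)
qed

lemma hat_x_Suc:
  assumes "i < d" "j < n"
  shows "hat (x (Suc t)) (i, j)
    = (1 + (1 - q) / (1 + q)) * hat (y (Suc t)) (i, j) - (1 - q) / (1 + q) * hat (y t) (i, j)"
  unfolding iterate_step(4)
  by (simp add: hat_minus hat_smult assms y_carrier)

lemma iterate_centered: "centered (x t) \<and> centered (y t)"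
proof (induction t)
  case 0
  have "hat (0\<^sub>m d n) (i, n - 1) = 0" if "i < d" for i
    using hat_last[of "0\<^sub>m d n" i] that by simp
  then show ?case by (simp add: centered_def iterate_step(1,2))
next
  case (Suc t)
  then have "centered (y (Suc t))"
    using n2 by (simp add: centered_def hat_y_Suc p_last[simplified])
  then show ?case using Suc n2 by (simp add: centered_def hat_x_Suc)
qed

lemma centered_minus:
  assumes "A \<in> carrier_mat d n" "B \<in> carrier_mat d n" "centered A" "centered B"
  shows "centered (A - B)"
  using assms n2 by (simp add: centered_def hat_minus)

end

section \<open>Linear convergence of the dual and primal iterates\<close>

context msda
begin

lemma \<theta>s_carrier: "\<theta>s \<in> carrier_vec d"
  using minimizer by (simp add: is_arg_min_def)

lemma grad_\<theta>s_carrier: "k < n \<Longrightarrow> gradient d (f k) \<theta>s \<in> carrier_vec d"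
  by (rule smooth_strongly_convex.grad_carrier[OF f \<theta>s_carrier])

lemma sum_grad_sprod:
  assumes v: "v \<in> carrier_vec d"
  shows "(\<Sum>k<n. gradient d (f k) \<theta>s \<bullet> v) = vec d (\<lambda>i. \<Sum>k<n. gradient d (f k) \<theta>s $ i) \<bullet> v"
proof -
  have "(\<Sum>k<n. gradient d (f k) \<theta>s \<bullet> v) = (\<Sum>k<n. \<Sum>i\<in>{0..<d}. gradient d (f k) \<theta>s $ i * v $ i)"
    using v by (simp add: scalar_prod_def)
  also have "\<dots> = (\<Sum>i\<in>{0..<d}. \<Sum>k<n. gradient d (f k) \<theta>s $ i * v $ i)" by (rule sum.swap)
  also have "\<dots> = vec d (\<lambda>i. \<Sum>k<n. gradient d (f k) \<theta>s $ i) \<bullet> v"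
    using v by (simp add: scalar_prod_def sum_distrib_right)
  finally show ?thesis .
qed

text \<open>
  Fermat's rule, obtained from the descent lemma: for the sum \<open>g\<close> of the
  gradients, the step \<open>- g / (n \<beta>)\<close> would decrease the objective unless \<open>g = 0\<close>.
\<close>

lemma sum_grad_zero: "vec d (\<lambda>i. \<Sum>k<n. gradient d (f k) \<theta>s $ i) = 0\<^sub>v d"
proof -
  define g where "g = vec d (\<lambda>i. \<Sum>k<n. gradient d (f k) \<theta>s $ i)"
  define s where "s = 1 / (real n * \<beta>)"
  define w where "w = \<theta>s + (- s) \<cdot>\<^sub>v g"
  have g: "g \<in> carrier_vec d" by (simp add: g_def)
  have s: "s > 0" using n2 \<beta>_pos by (simp add: s_def)
  have w: "w \<in> carrier_vec d" "w - \<theta>s = (- s) \<cdot>\<^sub>v g"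
    using \<theta>s_carrier g by (auto simp: w_def)
  have "(\<Sum>k<n. f k w) \<le> (\<Sum>k<n. f k \<theta>s + gradient d (f k) \<theta>s \<bullet> (w - \<theta>s) + \<beta> / 2 * ((w - \<theta>s) \<bullet> (w - \<theta>s)))"
    by (intro sum_mono smooth_strongly_convex.upper_bound[OF f \<theta>s_carrier w(1)]) auto
  also have "\<dots> = (\<Sum>k<n. f k \<theta>s) + g \<bullet> (w - \<theta>s) + real n * (\<beta> / 2 * ((w - \<theta>s) \<bullet> (w - \<theta>s)))"
    using sum_grad_sprod[of "w - \<theta>s"] w \<theta>s_carrier by (simp add: sum.distrib g_def)
  also have "\<dots> = (\<Sum>k<n. f k \<theta>s) + (- s * (g \<bullet> g) + real n * \<beta> / 2 * (s * (s * (g \<bullet> g))))"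
    using g unfolding w(2) by simp
  also have "real n * \<beta> / 2 * (s * (s * (g \<bullet> g))) = s / 2 * (g \<bullet> g)"
    using n2 \<beta>_pos by (simp add: s_def)
  finally have "(\<Sum>k<n. f k w) \<le> (\<Sum>k<n. f k \<theta>s) - s / 2 * (g \<bullet> g)" by simp
  moreover have "(\<Sum>k<n. f k \<theta>s) \<le> (\<Sum>k<n. f k w)"
  proof -
    have "avg_fun n f \<theta>s \<le> avg_fun n f w"
      using minimizer w(1) unfolding is_arg_min_def by (meson not_less)
    then show ?thesis using n2 by (simp add: avg_fun_def divide_le_cancel)
  qed
  ultimately have "s / 2 * (g \<bullet> g) \<le> 0" by linarith
  then have "g \<bullet> g = 0"
    using s sprod_self_ge_0[of g] by (simp add: mult_le_0_iff)
  then show ?thesis using sprod_self_eq_0[OF g] by (simp add: g_def)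
qed

lemma avg_gap_le:
  assumes v: "v \<in> carrier_vec d"
  shows "avg_fun n f v - avg_fun n f \<theta>s \<le> \<beta> / 2 * ((v - \<theta>s) \<bullet> (v - \<theta>s))"
proof -
  have "(\<Sum>k<n. f k v) \<le> (\<Sum>k<n. f k \<theta>s + gradient d (f k) \<theta>s \<bullet> (v - \<theta>s) + \<beta> / 2 * ((v - \<theta>s) \<bullet> (v - \<theta>s)))"
    by (intro sum_mono smooth_strongly_convex.upper_bound[OF f \<theta>s_carrier v]) auto
  also have "\<dots> = (\<Sum>k<n. f k \<theta>s) + real n * (\<beta> / 2 * ((v - \<theta>s) \<bullet> (v - \<theta>s)))"
    using sum_grad_sprod[of "v - \<theta>s"] v \<theta>s_carrier by (simp add: sum.distrib sum_grad_zero)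
  finally have "(1 / real n) * (\<Sum>k<n. f k v) \<le> (1 / real n) *
      ((\<Sum>k<n. f k \<theta>s) + real n * (\<beta> / 2 * ((v - \<theta>s) \<bullet> (v - \<theta>s))))"
    by (intro mult_left_mono) auto
  also have "\<dots> = avg_fun n f \<theta>s + \<beta> / 2 * ((v - \<theta>s) \<bullet> (v - \<theta>s))"
    using n2 by (simp add: avg_fun_def distrib_left)
  finally show ?thesis unfolding avg_fun_def by linarith
qed

lemma dual_opt_carrier: "dual_opt \<in> carrier_mat d n"
  unfolding dual_opt_def using mat_of_cols_carrier(1)[of d "map (\<lambda>k. gradient d (f k) \<theta>s) [0..<n]"] by simp

lemma col_dual_opt: "k < n \<Longrightarrow> col dual_opt k = gradient d (f k) \<theta>s"
  using grad_\<theta>s_carrier by (simp add: dual_opt_def)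

lemma col_\<Theta>_dual_opt: "k < n \<Longrightarrow> col (\<Theta> dual_opt) k = \<theta>s"
  using col_\<Theta>[OF dual_opt_carrier] col_dual_opt
    smooth_strongly_convex.gradient_conjugate_gradient[OF f \<theta>s_carrier] by simp

lemma sum_row_dual_opt: "i < d \<Longrightarrow> (\<Sum>k<n. dual_opt $$ (i, k)) = 0"
proof -
  assume i: "i < d"
  have "(\<Sum>k<n. dual_opt $$ (i, k)) = (\<Sum>k<n. gradient d (f k) \<theta>s $ i)"
    using i dual_opt_carrier
    by (intro sum.cong refl) (metis carrier_matD col_dual_opt index_col lessThan_iff)
  also have "\<dots> = vec d (\<lambda>i. \<Sum>k<n. gradient d (f k) \<theta>s $ i) $ i" using i by simp
  finally show ?thesis using i by (simp add: sum_grad_zero)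
qed

lemma dual_opt_centered: "centered dual_opt"
  using hat_last[OF dual_opt_carrier] sum_row_dual_opt by (simp add: centered_def)

text \<open>
  The gradient of the dual at \<open>dual_opt\<close> has \<open>\<theta>s\<close> in every column, so it is orthogonal to all
  differences of matrices with zero row sums, and strong convexity of the conjugates remains.
\<close>

lemma dual_growth:
  assumes Y: "Y \<in> carrier_mat d n" and cY: "centered Y"
  shows "frob (Y - dual_opt) (Y - dual_opt) / (2 * \<beta>) \<le> dual Y - dual dual_opt"
proof -
  have row: "(\<Sum>k<n. (Y - dual_opt) $$ (i, k)) = 0" if i: "i < d" for i
  proof -
    have "(\<Sum>k<n. Y $$ (i, k)) = 0"
      using hat_last[OF Y i] cY i c0_nonzero by (simp add: centered_def)
    then show ?thesis using i Y dual_opt_carrier sum_row_dual_opt[OF i] by (simp add: sum_subtractf)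
  qed
  have "frob (\<Theta> dual_opt) (Y - dual_opt) = (\<Sum>i<d. \<Sum>k<n. \<theta>s $ i * (Y - dual_opt) $$ (i, k))"
  proof -
    have "\<Theta> dual_opt $$ (i, k) = \<theta>s $ i" if "i < d" "k < n" for i k
      using col_\<Theta>_dual_opt[OF that(2)] \<Theta>_carrier[of dual_opt] that by (metis carrier_matD index_col)
    then show ?thesis using \<Theta>_carrier[of dual_opt] by (simp add: frob_def)
  qed
  also have "\<dots> = 0" by (simp add: sum_distrib_left[symmetric] row del: index_minus_mat)
  finally show ?thesis using dual_bounds(2)[OF dual_opt_carrier Y] by simp
qed

text \<open>
  The auxiliary sequence of Nesterov's method, directly in eigencoordinates.
\<close>

definition zhat :: "nat \<Rightarrow> nat \<times> nat \<Rightarrow> real" where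
  "zhat t ij = ((1 + q) * hat (x t) ij - hat (y t) ij) / q"

definition energy :: "nat \<Rightarrow> real" where
  "energy t = dual (y t) - dual dual_opt
     + L * q\<^sup>2 / 2 * (\<Sum>ij\<in>I. (zhat t ij - hat dual_opt ij)\<^sup>2 / p (snd ij))"

lemma p_pos: "ij \<in> I \<Longrightarrow> p (snd ij) > 0"
proof -
  assume "ij \<in> I"
  then have "(1 - c)\<^sup>2 / (1 + c\<^sup>2) \<le> p (snd ij)" using p_bounds by (auto simp: I_def)
  moreover have "(1 - c)\<^sup>2 / (1 + c\<^sup>2) > 0" using c by (intro divide_pos_pos add_pos_nonneg) auto
  ultimately show ?thesis by linarith
qed

lemma frob_diff_hat:
  assumes "A \<in> carrier_mat d n" "X \<in> carrier_mat d n" "Y \<in> carrier_mat d n" "centered X" "centered Y"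
  shows "frob A (X - Y) = (\<Sum>ij\<in>I. hat A ij * (hat X ij - hat Y ij))"
proof -
  have "frob A (X - Y) = (\<Sum>ij\<in>I. hat A ij * hat (X - Y) ij)"
    by (rule frob_hat[OF assms(1) minus_carrier_mat[OF assms(3)] centered_minus[OF assms(2-5)]])
  also have "\<dots> = (\<Sum>ij\<in>I. hat A ij * (hat X ij - hat Y ij))"
    by (intro sum.cong refl) (auto simp: I_def hat_minus[OF assms(2,3)])
  finally show ?thesis .
qed

lemma frob_diff_self_hat:
  assumes "X \<in> carrier_mat d n" "Y \<in> carrier_mat d n" "centered X" "centered Y"
  shows "frob (X - Y) (X - Y) = (\<Sum>ij\<in>I. (hat X ij - hat Y ij)\<^sup>2)"
proof -
  have "frob (X - Y) (X - Y) = (\<Sum>ij\<in>I. hat (X - Y) ij * (hat X ij - hat Y ij))"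
    by (rule frob_diff_hat[OF minus_carrier_mat[OF assms(2)] assms])
  also have "\<dots> = (\<Sum>ij\<in>I. (hat X ij - hat Y ij)\<^sup>2)"
    by (intro sum.cong refl) (auto simp: I_def hat_minus[OF assms(1,2)] power2_eq_square)
  finally show ?thesis .
qed

text \<open>
  In eigencoordinates the iteration is exactly the one of \<open>accelerated_gradient_step\<close>. The smoothness and
  strong convexity bounds of the conjugates are Euclidean; the bounds on the eigenvalues \<open>p\<close> convert them
  to the weighted norm.
\<close>

lemma energy_Suc: "energy (Suc t) \<le> (1 - q) * energy t"
  unfolding energy_def
proof (rule accelerated_gradient_step[where x = "hat (x t)" and y = "hat (y t)" and y' = "hat (y (Suc t))"
      and x' = "hat (x (Suc t))" and g = "hat (\<Theta> (x t))" and hx = "dual (x t)"])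
  let ?g = "hat (\<Theta> (x t))"
  note car = x_carrier[of t] y_carrier[of t] y_carrier[of "Suc t"] dual_opt_carrier
  note cent = iterate_centered[of t, THEN conjunct1] iterate_centered[of t, THEN conjunct2]
    iterate_centered[of "Suc t", THEN conjunct2] dual_opt_centered
  show y': "hat (y (Suc t)) ij = hat (x t) ij - p (snd ij) * ?g ij / L" if "ij \<in> I" for ij
    using that hat_y_Suc by (auto simp: I_def)
  show "hat (x (Suc t)) ij = (1 + (1 - q) / (1 + q)) * hat (y (Suc t)) ij - (1 - q) / (1 + q) * hat (y t) ij"
    if "ij \<in> I" for ij
    using that hat_x_Suc by (auto simp: I_def)
  show "dual (y (Suc t)) \<le> dual (x t) - (\<Sum>ij\<in>I. p (snd ij) * (?g ij)\<^sup>2) / (2 * L)"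
  proof -
    have diff: "hat (y (Suc t)) ij - hat (x t) ij = - (p (snd ij) * ?g ij / L)" if "ij \<in> I" for ij
      using y'[OF that] by simp
    have 1: "frob (\<Theta> (x t)) (y (Suc t) - x t) = - ((\<Sum>ij\<in>I. p (snd ij) * (?g ij)\<^sup>2) / L)"
      unfolding frob_diff_hat[OF \<Theta>_carrier car(3,1) cent(3,1)] sum_divide_distrib sum_negf[symmetric]
      by (intro sum.cong refl) (simp add: diff power2_eq_square)
    have "frob (y (Suc t) - x t) (y (Suc t) - x t)
        \<le> (\<Sum>ij\<in>I. (\<alpha> / L) * (p (snd ij) * (?g ij)\<^sup>2))"
      unfolding frob_diff_self_hat[OF car(3,1) cent(3,1)]
    proof (rule sum_mono)
      fix ij assume ij: "ij \<in> I"
      have "p (snd ij) \<le> L * \<alpha>"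
        using p_bounds ij \<alpha>_pos by (auto simp: I_def L_def)
      then have "p (snd ij) * (p (snd ij) * (?g ij)\<^sup>2) \<le> (L * \<alpha>) * (p (snd ij) * (?g ij)\<^sup>2)"
        using p_pos[OF ij] by (intro mult_right_mono) auto
      then have "p (snd ij) * (p (snd ij) * (?g ij)\<^sup>2) / L\<^sup>2 \<le> (L * \<alpha>) * (p (snd ij) * (?g ij)\<^sup>2) / L\<^sup>2"
        by (intro divide_right_mono) auto
      then show "(hat (y (Suc t)) ij - hat (x t) ij)\<^sup>2 \<le> (\<alpha> / L) * (p (snd ij) * (?g ij)\<^sup>2)"
        using L_pos by (simp add: diff[OF ij] power_divide power_mult_distrib power2_eq_square mult_ac)
    qed
    then have "frob (y (Suc t) - x t) (y (Suc t) - x t) / (2 * \<alpha>)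
        \<le> (\<alpha> / L) * (\<Sum>ij\<in>I. p (snd ij) * (?g ij)\<^sup>2) / (2 * \<alpha>)"
      using \<alpha>_pos unfolding sum_distrib_left[symmetric] by (intro divide_right_mono) auto
    also have "\<dots> = (\<Sum>ij\<in>I. p (snd ij) * (?g ij)\<^sup>2) / (2 * L)" using \<alpha>_pos by simp
    finally have 2: "frob (y (Suc t) - x t) (y (Suc t) - x t) / (2 * \<alpha>)
        \<le> (\<Sum>ij\<in>I. p (snd ij) * (?g ij)\<^sup>2) / (2 * L)" .
    have "P / L = P / (2 * L) + P / (2 * L)" for P :: real using L_pos by (simp add: field_simps)
    from this[of "\<Sum>ij\<in>I. p (snd ij) * (?g ij)\<^sup>2"] show ?thesis
      using dual_bounds(1)[OF car(1,3)] 1 2 by linarith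
  qed
  show "dual (x t) + (\<Sum>ij\<in>I. ?g ij * (hat dual_opt ij - hat (x t) ij))
      + L * q\<^sup>2 / 2 * (\<Sum>ij\<in>I. (hat dual_opt ij - hat (x t) ij)\<^sup>2 / p (snd ij)) \<le> dual dual_opt"
  proof -
    have "L * q\<^sup>2 / 2 * (\<Sum>ij\<in>I. (hat dual_opt ij - hat (x t) ij)\<^sup>2 / p (snd ij))
        = (\<Sum>ij\<in>I. L * q\<^sup>2 / 2 * ((hat dual_opt ij - hat (x t) ij)\<^sup>2 / p (snd ij)))"
      by (rule sum_distrib_left)
    also have "\<dots> \<le> (\<Sum>ij\<in>I. (hat dual_opt ij - hat (x t) ij)\<^sup>2 / (2 * \<beta>))"
    proof (rule sum_mono)
      fix ij assume ij: "ij \<in> I"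
      have "(1 - c)\<^sup>2 / (1 + c\<^sup>2) \<le> p (snd ij)" using p_bounds ij by (auto simp: I_def)
      then have "L * q\<^sup>2 \<le> p (snd ij) / \<beta>"
        unfolding L_q_sq using \<beta>_pos by (intro divide_right_mono) auto
      then have "L * q\<^sup>2 / p (snd ij) \<le> 1 / \<beta>" using p_pos[OF ij] by (simp add: pos_divide_le_eq)
      then have "(hat dual_opt ij - hat (x t) ij)\<^sup>2 / 2 * (L * q\<^sup>2 / p (snd ij))
          \<le> (hat dual_opt ij - hat (x t) ij)\<^sup>2 / 2 * (1 / \<beta>)"
        by (rule mult_left_mono) simp
      then show "L * q\<^sup>2 / 2 * ((hat dual_opt ij - hat (x t) ij)\<^sup>2 / p (snd ij))
          \<le> (hat dual_opt ij - hat (x t) ij)\<^sup>2 / (2 * \<beta>)" by (simp add: mult_ac)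
    qed
    also have "\<dots> = frob (dual_opt - x t) (dual_opt - x t) / (2 * \<beta>)"
      unfolding frob_diff_self_hat[OF car(4,1) cent(4,1)] by (rule sum_divide_distrib[symmetric])
    finally show ?thesis
      using dual_bounds(2)[OF car(1,4)] unfolding frob_diff_hat[OF \<Theta>_carrier car(4,1) cent(4,1)]
      by linarith
  qed
  show "dual (x t) + (\<Sum>ij\<in>I. ?g ij * (hat (y t) ij - hat (x t) ij)) \<le> dual (y t)"
  proof -
    have "frob (y t - x t) (y t - x t) / (2 * \<beta>) \<ge> 0"
      unfolding frob_diff_self_hat[OF car(2,1) cent(2,1)] using \<beta>_pos by (simp add: sum_nonneg)
    then show ?thesis
      using dual_bounds(2)[OF car(1,2)] unfolding frob_diff_hat[OF \<Theta>_carrier car(2,1) cent(2,1)]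
      by linarith
  qed
qed (use p_pos q_pos q_le_1 L_pos in \<open>auto simp: zhat_def\<close>)

lemma energy_le: "energy t \<le> (1 - q) ^ t * energy 0"
proof (induction t)
  case (Suc t)
  have "energy (Suc t) \<le> (1 - q) * energy t" by (rule energy_Suc)
  also have "\<dots> \<le> (1 - q) * ((1 - q) ^ t * energy 0)"
    using Suc q_le_1 by (intro mult_left_mono) auto
  finally show ?case by simp
qed simp

text \<open>
  The energy controls \<open>y\<close> through \<open>dual_growth\<close> (factor \<open>2 \<beta>\<close>) and \<open>z\<close> through its quadratic term
  (factor \<open>2 \<alpha> / q\<^sup>2\<close> after passing to the Euclidean norm).
\<close>

definition B :: real where "B = (2 * \<beta> + 2 * \<alpha> / q\<^sup>2) * energy 0"

lemma dual_iterates_converge: "frob (x t - dual_opt) (x t - dual_opt) \<le> B * (1 - q) ^ t"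
proof -
  note cent = iterate_centered[of t, THEN conjunct1] iterate_centered[of t, THEN conjunct2]
  define Y where "Y = (\<Sum>ij\<in>I. (hat (y t) ij - hat dual_opt ij)\<^sup>2)"
  define Z where "Z = (\<Sum>ij\<in>I. (zhat t ij - hat dual_opt ij)\<^sup>2)"
  define Zp where "Zp = (\<Sum>ij\<in>I. (zhat t ij - hat dual_opt ij)\<^sup>2 / p (snd ij))"
  have Zp0: "Zp \<ge> 0" unfolding Zp_def using p_pos by (intro sum_nonneg divide_nonneg_pos) auto
  have gY: "Y / (2 * \<beta>) \<le> dual (y t) - dual dual_opt"
    using dual_growth[OF y_carrier cent(2)]
    unfolding frob_diff_self_hat[OF y_carrier dual_opt_carrier cent(2) dual_opt_centered] Y_def .
  have Y0: "Y \<ge> 0" by (simp add: Y_def sum_nonneg)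
  have en: "energy t = dual (y t) - dual dual_opt + L * q\<^sup>2 / 2 * Zp" by (simp add: energy_def Zp_def)
  have "L * q\<^sup>2 / 2 * Zp \<ge> 0" using L_pos Zp0 by (intro mult_nonneg_nonneg) auto
  then have "Y / (2 * \<beta>) \<le> energy t" using en gY by linarith
  then have Yle: "Y \<le> 2 * \<beta> * energy t" using \<beta>_pos by (simp add: pos_divide_le_eq mult.commute)
  have "Y / (2 * \<beta>) \<ge> 0" using Y0 \<beta>_pos by simp
  then have Zple: "L * q\<^sup>2 / 2 * Zp \<le> energy t" using en gY by linarith
  have "Z \<le> (\<Sum>ij\<in>I. L * \<alpha> * ((zhat t ij - hat dual_opt ij)\<^sup>2 / p (snd ij)))"
    unfolding Z_def
  proof (rule sum_mono)
    fix ij assume ij: "ij \<in> I"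
    have "p (snd ij) \<le> L * \<alpha>" using p_bounds ij \<alpha>_pos by (auto simp: I_def L_def)
    then have "p (snd ij) * ((zhat t ij - hat dual_opt ij)\<^sup>2 / p (snd ij))
        \<le> L * \<alpha> * ((zhat t ij - hat dual_opt ij)\<^sup>2 / p (snd ij))"
      using p_pos[OF ij] by (intro mult_right_mono) auto
    then show "(zhat t ij - hat dual_opt ij)\<^sup>2 \<le> L * \<alpha> * ((zhat t ij - hat dual_opt ij)\<^sup>2 / p (snd ij))"
      using p_pos[OF ij] by simp
  qed
  also have "\<dots> = 2 * \<alpha> / q\<^sup>2 * (L * q\<^sup>2 / 2 * Zp)"
    using q_pos by (simp add: Zp_def sum_distrib_left mult_ac)
  also have "\<dots> \<le> 2 * \<alpha> / q\<^sup>2 * energy t" using Zple \<alpha>_pos by (intro mult_left_mono) auto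
  finally have Zle: "Z \<le> 2 * \<alpha> / q\<^sup>2 * energy t" .
  have "frob (x t - dual_opt) (x t - dual_opt) = (\<Sum>ij\<in>I. (hat (x t) ij - hat dual_opt ij)\<^sup>2)"
    by (rule frob_diff_self_hat[OF x_carrier dual_opt_carrier cent(1) dual_opt_centered])
  also have "\<dots> \<le> (\<Sum>ij\<in>I. (hat (y t) ij - hat dual_opt ij)\<^sup>2 + (zhat t ij - hat dual_opt ij)\<^sup>2)"
  proof (rule sum_mono)
    fix ij
    \<comment> \<open>\<open>x\<close> is a convex combination of \<open>y\<close> and \<open>z\<close>.\<close>
    define a b e where "a = hat (y t) ij - hat dual_opt ij" and "b = zhat t ij - hat dual_opt ij"
      and "e = hat (x t) ij - hat dual_opt ij"
    have "q * zhat t ij = (1 + q) * hat (x t) ij - hat (y t) ij" using q_pos by (simp add: zhat_def)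
    then have e: "(1 + q) * e = a + q * b" by (simp add: a_def b_def e_def algebra_simps)
    have "((1 + q) * e)\<^sup>2 + q * (a - b)\<^sup>2 = (1 + q) * (a\<^sup>2 + q * b\<^sup>2)"
      unfolding e by (simp add: power2_eq_square algebra_simps)
    moreover have "q * (a - b)\<^sup>2 \<ge> 0" using q_pos by simp
    moreover have "((1 + q) * e)\<^sup>2 = (1 + q) * ((1 + q) * e\<^sup>2)" by (simp add: power2_eq_square)
    ultimately have "(1 + q) * ((1 + q) * e\<^sup>2) \<le> (1 + q) * (a\<^sup>2 + q * b\<^sup>2)" by linarith
    then have "(1 + q) * e\<^sup>2 \<le> a\<^sup>2 + q * b\<^sup>2" using q_pos by simp
    moreover have "0 \<le> q * e\<^sup>2" "q * b\<^sup>2 \<le> 1 * b\<^sup>2" using q_pos q_le_1 by (simp, intro mult_right_mono) auto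
    ultimately have "e\<^sup>2 \<le> a\<^sup>2 + b\<^sup>2" by (simp add: distrib_right)
    then show "(hat (x t) ij - hat dual_opt ij)\<^sup>2
        \<le> (hat (y t) ij - hat dual_opt ij)\<^sup>2 + (zhat t ij - hat dual_opt ij)\<^sup>2"
      by (simp add: a_def b_def e_def)
  qed
  also have "\<dots> = Y + Z" by (simp add: Y_def Z_def sum.distrib)
  also have "\<dots> \<le> (2 * \<beta> + 2 * \<alpha> / q\<^sup>2) * energy t" using Yle Zle by (simp add: distrib_right)
  also have "\<dots> \<le> (2 * \<beta> + 2 * \<alpha> / q\<^sup>2) * ((1 - q) ^ t * energy 0)"
    using energy_le \<alpha>_pos \<beta>_pos by (intro mult_left_mono) auto
  finally show ?thesis by (simp add: B_def mult_ac)
qed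

lemma B_nonneg: "B \<ge> 0"
proof -
  have "0 \<le> frob (x 0 - dual_opt) (x 0 - dual_opt)"
    by (auto simp: frob_def intro!: sum_nonneg)
  then show ?thesis using dual_iterates_converge[of 0] by simp
qed

lemma primal_iterates_converge:
  assumes k: "k < n"
  shows "(col (\<Theta> (x t)) k - \<theta>s) \<bullet> (col (\<Theta> (x t)) k - \<theta>s) \<le> B / \<alpha>\<^sup>2 * (1 - q) ^ t"
proof -
  interpret smooth_strongly_convex d "f k" \<alpha> \<beta> by (rule f[OF k])
  have xc: "col (x t) k \<in> carrier_vec d" and oc: "col dual_opt k \<in> carrier_vec d"
    by (metis carrier_matD(1) col_dim x_carrier) (metis carrier_matD(1) col_dim dual_opt_carrier)
  have XO: "x t - dual_opt \<in> carrier_mat d n" by (rule minus_carrier_mat[OF dual_opt_carrier])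
  have "(col (\<Theta> (x t)) k - \<theta>s) \<bullet> (col (\<Theta> (x t)) k - \<theta>s)
      \<le> ((col (x t) k - col dual_opt k) \<bullet> (col (x t) k - col dual_opt k)) / \<alpha>\<^sup>2"
    using gradient_conjugate_Lipschitz[OF xc oc]
    by (simp add: col_\<Theta>[OF x_carrier k] col_\<Theta>[OF dual_opt_carrier k, symmetric] col_\<Theta>_dual_opt[OF k])
  also have "col (x t) k - col dual_opt k = col (x t - dual_opt) k"
    using x_carrier[of t] dual_opt_carrier k by (intro eq_vecI) auto
  also have "(col (x t - dual_opt) k \<bullet> col (x t - dual_opt) k) / \<alpha>\<^sup>2
      \<le> frob (x t - dual_opt) (x t - dual_opt) / \<alpha>\<^sup>2"
    unfolding frob_eq_sum_cols[OF XO XO]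
    by (intro divide_right_mono member_le_sum) (use k sprod_self_ge_0 in auto)
  also have "\<dots> \<le> B * (1 - q) ^ t / \<alpha>\<^sup>2"
    using dual_iterates_converge by (intro divide_right_mono) auto
  finally show ?thesis by simp
qed

lemma col_\<Theta>_carrier: "col (\<Theta> X) k \<in> carrier_vec d"
  by (metis carrier_matD(1) col_dim \<Theta>_carrier)

lemma Theta_tendsto: "mat_tendsto d n (msda_Theta d n W f \<alpha> \<beta>) (mat_of_cols d (replicate n \<theta>s))"
  unfolding mat_tendsto_def
proof (intro allI impI)
  fix i k assume i: "i < d" and k: "k < n"
  have lim: "(\<lambda>t. sqrt (B / \<alpha>\<^sup>2 * (1 - q) ^ t)) \<longlonglongrightarrow> sqrt (B / \<alpha>\<^sup>2 * 0)"
    using q_pos q_le_1 by (intro tendsto_real_sqrt tendsto_mult_left LIMSEQ_realpow_zero) auto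
  have bound: "norm (msda_Theta d n W f \<alpha> \<beta> t $$ (i, k) - \<theta>s $ i) \<le> sqrt (B / \<alpha>\<^sup>2 * (1 - q) ^ t)" for t
  proof -
    have "msda_Theta d n W f \<alpha> \<beta> t $$ (i, k) - \<theta>s $ i = (col (\<Theta> (x t)) k - \<theta>s) $ i"
      using i k \<Theta>_carrier[of "x t"] \<theta>s_carrier by (simp add: msda_Theta_def x_def)
    also have "\<bar>\<dots>\<bar> \<le> vnorm (col (\<Theta> (x t)) k - \<theta>s)"
      by (rule abs_index_le_vnorm) (use i \<theta>s_carrier in simp)
    also have "\<dots> \<le> sqrt (B / \<alpha>\<^sup>2 * (1 - q) ^ t)"
      unfolding vnorm_def using primal_iterates_converge[OF k] by simp
    finally show ?thesis by simp
  qed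
  have "(\<lambda>t. msda_Theta d n W f \<alpha> \<beta> t $$ (i, k) - \<theta>s $ i) \<longlonglongrightarrow> 0"
  proof (rule tendsto_norm_zero_cancel, rule real_tendsto_sandwich[where f = "\<lambda>_. 0"])
    show "(\<lambda>t. sqrt (B / \<alpha>\<^sup>2 * (1 - q) ^ t)) \<longlonglongrightarrow> 0" using lim by simp
  qed (use bound in simp_all)
  then have "(\<lambda>t. msda_Theta d n W f \<alpha> \<beta> t $$ (i, k)) \<longlonglongrightarrow> \<theta>s $ i"
    by (rule LIM_zero_cancel)
  moreover have "mat_of_cols d (replicate n \<theta>s) $$ (i, k) = \<theta>s $ i"
    using i k by (simp add: mat_of_cols_def)
  ultimately show "(\<lambda>t. msda_Theta d n W f \<alpha> \<beta> t $$ (i, k)) \<longlonglongrightarrow> mat_of_cols d (replicate n \<theta>s) $$ (i, k)"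
    by simp
qed

end

section \<open>Complexity of the method\<close>

context msda
begin

lemma precision_reached:
  assumes "\<beta> / 2 * (B / \<alpha>\<^sup>2 * (1 - q) ^ t) \<le> \<epsilon>"
  shows "Max ((\<lambda>k. avg_fun n f (col (msda_Theta d n W f \<alpha> \<beta> t) k)) ` {..<n}) - avg_fun n f \<theta>s \<le> \<epsilon>"
proof -
  have "avg_fun n f (col (msda_Theta d n W f \<alpha> \<beta> t) k) \<le> avg_fun n f \<theta>s + \<epsilon>" if k: "k < n" for k
  proof -
    have "avg_fun n f (col (\<Theta> (x t)) k) - avg_fun n f \<theta>s
        \<le> \<beta> / 2 * ((col (\<Theta> (x t)) k - \<theta>s) \<bullet> (col (\<Theta> (x t)) k - \<theta>s))"
      by (rule avg_gap_le[OF col_\<Theta>_carrier])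
    also have "\<dots> \<le> \<beta> / 2 * (B / \<alpha>\<^sup>2 * (1 - q) ^ t)"
      using primal_iterates_converge[OF k] \<beta>_pos by (intro mult_left_mono) auto
    also note assms
    finally show ?thesis by (simp add: msda_Theta_def x_def)
  qed
  moreover have "{..<n} \<noteq> {}" using n2 by (auto simp: lessThan_empty_iff)
  ultimately have "Max ((\<lambda>k. avg_fun n f (col (msda_Theta d n W f \<alpha> \<beta> t) k)) ` {..<n}) \<le> avg_fun n f \<theta>s + \<epsilon>"
    by (subst Max_le_iff) auto
  then show ?thesis by simp
qed

text \<open>
  By \<open>(1 - q)\<^sup>t \<le> exp (- q t)\<close>, about \<open>ln (A / \<epsilon>) / q\<close> iterations suffice, where \<open>A\<close> bounds the initial error;
  the parts coming from \<open>A\<close> and from rounding up do not involve \<open>\<epsilon>\<close>.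
\<close>

lemma msda_time_le:
  assumes \<tau>: "\<tau> > 0"
  shows "\<exists>D\<ge>0. \<forall>\<epsilon>. 0 < \<epsilon> \<and> \<epsilon> < 1 \<longrightarrow> msda_time d n W f \<alpha> \<beta> \<tau> \<theta>s \<epsilon>
     \<le> ereal (1 / q * (1 + real (msda_K (eigengap n W)) * \<tau>) * ln (1 / \<epsilon>) + D)"
proof -
  \<comment> \<open>The summand \<open>1\<close> makes \<open>ln A\<close> nonnegative.\<close>
  define A where "A = \<beta> / 2 * (B / \<alpha>\<^sup>2) + 1"
  define T where "T = 1 + real (msda_K (eigengap n W)) * \<tau>"
  have A: "A \<ge> 1" using B_nonneg \<beta>_pos by (simp add: A_def)
  have T: "T \<ge> 0" using \<tau> by (simp add: T_def)
  show ?thesis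
  proof (intro exI[of _ "(ln A / q + 1) * T"] conjI allI impI)
    show "(ln A / q + 1) * T \<ge> 0" using A q_pos T by (intro mult_nonneg_nonneg add_nonneg_nonneg) auto
    fix \<epsilon> :: real assume \<epsilon>: "0 < \<epsilon> \<and> \<epsilon> < 1"
    define t where "t = nat \<lceil>ln (A / \<epsilon>) / q\<rceil>"
    have "ln (A / \<epsilon>) / q \<ge> 0" using A \<epsilon> q_pos by (intro divide_nonneg_pos) (auto simp: divide_simps)
    then have t: "ln (A / \<epsilon>) / q \<le> real t" "real t \<le> ln (A / \<epsilon>) / q + 1"
      unfolding t_def by linarith+
    have "(1 - q) ^ t \<le> exp (- q) ^ t"
      using q_le_1 exp_ge_add_one_self[of "- q"] by (intro power_mono) auto
    also have "\<dots> = exp (- (q * real t))" by (simp add: exp_of_nat_mult[symmetric] mult.commute)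
    also have "\<dots> \<le> exp (- ln (A / \<epsilon>))" using t(1) q_pos by (simp add: pos_divide_le_eq mult.commute)
    also have "\<dots> = \<epsilon> / A" using A \<epsilon> by (simp add: exp_minus)
    finally have "A * (1 - q) ^ t \<le> A * (\<epsilon> / A)" using A by (intro mult_left_mono) auto
    moreover have "\<beta> / 2 * (B / \<alpha>\<^sup>2) * (1 - q) ^ t \<le> A * (1 - q) ^ t"
      using q_le_1 by (intro mult_right_mono) (auto simp: A_def)
    ultimately have "\<beta> / 2 * (B / \<alpha>\<^sup>2 * (1 - q) ^ t) \<le> \<epsilon>" using A by simp
    then have "msda_time d n W f \<alpha> \<beta> \<tau> \<theta>s \<epsilon> \<le> ereal (real t * T)"
      unfolding msda_time_def T_def using precision_reached by (intro INF_lower) simp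
    also have "real t * T \<le> (ln (A / \<epsilon>) / q + 1) * T" using t(2) T by (intro mult_right_mono)
    also have "ln (A / \<epsilon>) = ln (1 / \<epsilon>) + ln A" using A \<epsilon> by (simp add: ln_div)
    also have "((ln (1 / \<epsilon>) + ln A) / q + 1) * T = 1 / q * T * ln (1 / \<epsilon>) + (ln A / q + 1) * T"
      using q_pos by (simp add: field_simps)
    finally show "msda_time d n W f \<alpha> \<beta> \<tau> \<theta>s \<epsilon>
        \<le> ereal (1 / q * (1 + real (msda_K (eigengap n W)) * \<tau>) * ln (1 / \<epsilon>) + (ln A / q + 1) * T)"
      by (simp add: T_def)
  qed
qed

end

text \<open>
  The number of gossip rounds is at least \<open>1 / (2 \<surd>\<gamma>)\<close> and at most \<open>1 / \<surd>\<gamma>\<close>. The lower bound and Bernoulli's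
  inequality make \<open>c = c1\<^sup>K\<close> at most \<open>1/2\<close>, so that the accelerated gossip has a condition number bounded
  by an absolute constant; the upper bound is the communication cost of an iteration.
\<close>

lemma msda_c1_power_le:
  assumes "0 < \<gamma>" "\<gamma> < 1"
  shows "msda_c1 \<gamma> ^ msda_K \<gamma> \<le> 1 / 2" and "0 < msda_c1 \<gamma> ^ msda_K \<gamma>"
    and "real (msda_K \<gamma>) \<le> 1 / sqrt \<gamma>"
proof -
  define s where "s = sqrt \<gamma>"
  have s: "0 < s" "s < 1" using assms by (auto simp: s_def)
  have c1: "msda_c1 \<gamma> = (1 - s) / (1 + s)" by (simp add: msda_c1_def s_def)
  show pos: "0 < msda_c1 \<gamma> ^ msda_K \<gamma>" unfolding c1 using s by (intro zero_less_power divide_pos_pos) auto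
  have inv: "1 / s \<ge> 1" using s by simp
  then show "real (msda_K \<gamma>) \<le> 1 / sqrt \<gamma>"
    unfolding msda_K_def s_def[symmetric] by linarith
  \<comment> \<open>Rounding down a number that is at least \<open>1\<close> loses at most half of it.\<close>
  have "real (msda_K \<gamma>) \<ge> 1 / (2 * s)"
  proof -
    have "real (msda_K \<gamma>) \<ge> 1" "real (msda_K \<gamma>) > 1 / s - 1"
    proof -
      have "\<lfloor>1 / s\<rfloor> \<ge> 1" using inv by (simp add: le_floor_iff)
      then show "real (msda_K \<gamma>) \<ge> 1" "real (msda_K \<gamma>) > 1 / s - 1"
        unfolding msda_K_def s_def[symmetric] by linarith+
    qed
    moreover have "1 / (2 * s) = (1 / s) / 2" by simp
    ultimately show ?thesis by linarith
  qed
  then have "2 * s * real (msda_K \<gamma>) \<ge> 2 * s * (1 / (2 * s))" using s by (intro mult_left_mono) auto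
  then have "2 \<le> 1 + real (msda_K \<gamma>) * (2 * s)" using s by (simp add: mult_ac)
  also have "\<dots> \<le> (1 + 2 * s) ^ msda_K \<gamma>" using s Bernoulli_inequality[of "2 * s" "msda_K \<gamma>"] by simp
  also have "\<dots> \<le> ((1 + s) / (1 - s)) ^ msda_K \<gamma>"
  proof (rule power_mono)
    have "(1 + 2 * s) * (1 - s) \<le> 1 + s" using s by (simp add: algebra_simps)
    then show "1 + 2 * s \<le> (1 + s) / (1 - s)" using s by (simp add: pos_le_divide_eq)
  qed (use s in simp)
  also have "\<dots> = 1 / msda_c1 \<gamma> ^ msda_K \<gamma>" unfolding c1 by (simp add: power_divide)
  finally show "msda_c1 \<gamma> ^ msda_K \<gamma> \<le> 1 / 2" using pos by (simp add: field_simps)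
qed

theorem theorem4:
  shows "\<exists>C::real. C > 0 \<and>
    (\<forall>(n::nat) (d::nat) (G::nat pair_pre_digraph) (W::real mat)
        (f::nat \<Rightarrow> real vec \<Rightarrow> real) (\<alpha>::real) (\<beta>::real) (\<tau>::real) (\<theta>s::real vec).
      n \<ge> 2 \<longrightarrow>
      pair_graph G \<longrightarrow> pverts G = {..<n} \<longrightarrow> Digraph_Component.connected (with_proj G) \<longrightarrow>
      \<tau> > 0 \<longrightarrow>
      gossip_matrix n G W \<longrightarrow> eigengap n W < 1 \<longrightarrow>
      0 < \<alpha> \<longrightarrow> \<alpha> \<le> \<beta> \<longrightarrow>
      (\<forall>i<n. strongly_convex d \<alpha> (f i) \<and> smooth_fun d \<beta> (f i)) \<longrightarrow>
      is_arg_min (avg_fun n f) (\<lambda>\<theta>. \<theta> \<in> carrier_vec d) \<theta>s \<longrightarrow>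
      mat_tendsto d n (msda_Theta d n W f \<alpha> \<beta>) (mat_of_cols d (replicate n \<theta>s)) \<and>
      (\<exists>D\<ge>0. \<forall>\<epsilon>. 0 < \<epsilon> \<and> \<epsilon> < 1 \<longrightarrow>
         msda_time d n W f \<alpha> \<beta> \<tau> \<theta>s \<epsilon>
           \<le> ereal (C * sqrt (\<beta> / \<alpha>) * (1 + \<tau> / sqrt (eigengap n W)) * ln (1 / \<epsilon>) + D)))"
proof (rule exI[of _ 3], rule conjI)
  show "(0::real) < 3" by simp
  show "\<forall>n d G W f \<alpha> \<beta> \<tau> \<theta>s.
      n \<ge> 2 \<longrightarrow>
      pair_graph G \<longrightarrow> pverts G = {..<n} \<longrightarrow> Digraph_Component.connected (with_proj G) \<longrightarrow>
      \<tau> > 0 \<longrightarrow>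
      gossip_matrix n G W \<longrightarrow> eigengap n W < 1 \<longrightarrow>
      0 < \<alpha> \<longrightarrow> \<alpha> \<le> \<beta> \<longrightarrow>
      (\<forall>i<n. strongly_convex d \<alpha> (f i) \<and> smooth_fun d \<beta> (f i)) \<longrightarrow>
      is_arg_min (avg_fun n f) (\<lambda>\<theta>. \<theta> \<in> carrier_vec d) \<theta>s \<longrightarrow>
      mat_tendsto d n (msda_Theta d n W f \<alpha> \<beta>) (mat_of_cols d (replicate n \<theta>s)) \<and>
      (\<exists>D\<ge>0. \<forall>\<epsilon>. 0 < \<epsilon> \<and> \<epsilon> < 1 \<longrightarrow>
         msda_time d n W f \<alpha> \<beta> \<tau> \<theta>s \<epsilon>
           \<le> ereal (3 * sqrt (\<beta> / \<alpha>) * (1 + \<tau> / sqrt (eigengap n W)) * ln (1 / \<epsilon>) + D))"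
  proof (intro allI impI)
    fix n d :: nat and G :: "nat pair_pre_digraph" and W :: "real mat"
      and f :: "nat \<Rightarrow> real vec \<Rightarrow> real" and \<alpha> \<beta> \<tau> :: real and \<theta>s :: "real vec"
    assume n: "n \<ge> 2" and \<tau>: "\<tau> > 0" and W: "gossip_matrix n G W" and \<gamma>1: "eigengap n W < 1"
      and \<alpha>: "0 < \<alpha>" and \<alpha>\<beta>: "\<alpha> \<le> \<beta>"
      and f: "\<forall>i<n. strongly_convex d \<alpha> (f i) \<and> smooth_fun d \<beta> (f i)"
      and min: "is_arg_min (avg_fun n f) (\<lambda>\<theta>. \<theta> \<in> carrier_vec d) \<theta>s"
    define K where "K = msda_K (eigengap n W)"
    define c where "c = msda_c1 (eigengap n W) ^ K"
    obtain U p where \<gamma>0: "eigengap n W > 0" and U: "U \<in> carrier_mat n n" "transpose_mat U * U = 1\<^sub>m n"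
      and last: "\<exists>c. col U (n - 1) = c \<cdot>\<^sub>v ones n" and p0: "p (n - 1) = 0"
      and pj: "\<And>j. j < n - 1 \<Longrightarrow> (1 - c)\<^sup>2 / (1 + c\<^sup>2) \<le> p j \<and> p j \<le> (1 + c)\<^sup>2 / (1 + c\<^sup>2)"
      and car: "\<And>d X. X \<in> carrier_mat d n \<Longrightarrow> acc_gossip n X W K \<in> carrier_mat d n"
      and hat: "\<And>d X i j. X \<in> carrier_mat d n \<Longrightarrow> i < d \<Longrightarrow> j < n \<Longrightarrow>
        (acc_gossip n X W K * U) $$ (i, j) = p j * (X * U) $$ (i, j)"
      by (rule acc_gossip_spectrum[OF W n \<gamma>1, of K, folded c_def]) (rule that)
    obtain c0 where c0: "col U (n - 1) = c0 \<cdot>\<^sub>v ones n" using last by blast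
    note c_bounds = msda_c1_power_le[OF \<gamma>0 \<gamma>1, folded K_def, folded c_def]
    interpret msda n d W U p f \<alpha> \<beta> c c0 \<theta>s
      by unfold_locales (use n f \<alpha> \<alpha>\<beta> c_bounds U c0 p0 pj car hat min in
          \<open>auto simp: c_def K_def smooth_strongly_convex_def\<close>)
    \<comment> \<open>\<open>c \<le> 1/2\<close> gives \<open>(1 + c) / (1 - c) \<le> 3\<close>; this is the absolute constant of the theorem.\<close>
    have rate: "1 / q \<le> 3 * sqrt (\<beta> / \<alpha>)"
    proof -
      have "1 / q = (1 + c) / (1 - c) * sqrt (\<beta> / \<alpha>)" by (simp add: q_def)
      moreover have "(1 + c) / (1 - c) \<le> 3" using c_bounds by (simp add: pos_divide_le_eq)
      then have "(1 + c) / (1 - c) * sqrt (\<beta> / \<alpha>) \<le> 3 * sqrt (\<beta> / \<alpha>)"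
        using \<alpha> \<alpha>\<beta> by (intro mult_right_mono) auto
      ultimately show ?thesis by simp
    qed
    have "real K * \<tau> \<le> 1 / sqrt (eigengap n W) * \<tau>" using c_bounds(3) \<tau> by (intro mult_right_mono) auto
    then have cost: "1 + real K * \<tau> \<le> 1 + \<tau> / sqrt (eigengap n W)" by simp
    have "1 / q * (1 + real K * \<tau>) \<le> 3 * sqrt (\<beta> / \<alpha>) * (1 + \<tau> / sqrt (eigengap n W))"
      using rate cost \<tau> \<alpha> \<alpha>\<beta> by (intro mult_mono) auto
    then have coef: "1 / q * (1 + real K * \<tau>) * ln (1 / \<epsilon>)
        \<le> 3 * sqrt (\<beta> / \<alpha>) * (1 + \<tau> / sqrt (eigengap n W)) * ln (1 / \<epsilon>)" if "0 < \<epsilon>" "\<epsilon> < 1" for \<epsilon>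
      using that by (intro mult_right_mono) auto
    obtain D where D: "D \<ge> 0" "\<And>\<epsilon>. 0 < \<epsilon> \<and> \<epsilon> < 1 \<Longrightarrow> msda_time d n W f \<alpha> \<beta> \<tau> \<theta>s \<epsilon>
       \<le> ereal (1 / q * (1 + real K * \<tau>) * ln (1 / \<epsilon>) + D)"
      using msda_time_le[OF \<tau>] unfolding K_def by blast
    have "msda_time d n W f \<alpha> \<beta> \<tau> \<theta>s \<epsilon>
           \<le> ereal (3 * sqrt (\<beta> / \<alpha>) * (1 + \<tau> / sqrt (eigengap n W)) * ln (1 / \<epsilon>) + D)"
      if "0 < \<epsilon> \<and> \<epsilon> < 1" for \<epsilon>
      by (rule order_trans[OF D(2)[OF that]]) (use coef that in simp)
    then show "mat_tendsto d n (msda_Theta d n W f \<alpha> \<beta>) (mat_of_cols d (replicate n \<theta>s)) \<and>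
      (\<exists>D\<ge>0. \<forall>\<epsilon>. 0 < \<epsilon> \<and> \<epsilon> < 1 \<longrightarrow>
         msda_time d n W f \<alpha> \<beta> \<tau> \<theta>s \<epsilon>
           \<le> ereal (3 * sqrt (\<beta> / \<alpha>) * (1 + \<tau> / sqrt (eigengap n W)) * ln (1 / \<epsilon>) + D))"
      using Theta_tendsto D(1) by blast
  qed
qed

end
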